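(* Let $G$ be a topological group, let $X$ be a metric space equipped with a cobounded, isometric action of $G$, and choose $x\in X$. Suppose that $X$ is connected or that $X$ is geodesic. Then there exists a generating set $S$ for $G$ such that the following hold. (1) If $X$ is connected, the word metric $d_S$ satisfies $d_S\succeq d_{X,x}$. (2) If $X$ is geodesic, $d_S\asymp d_{X,x}$. (3) If the action of $G$ on $X$ is quasi-continuous, then $S$ contains an identity neighborhood of $G$, and there exists a pseudometric $\widehat{d_S}\in \mathrm{PMet}(G)$ which is quasi-isometric to $d_S$ (that is, $\widehat{d_S}\asymp d_S$). (4) If the action is quasi-continuous and $G$ is non-Archimedean, then there is a connected graph $\Gamma$ on which $G$ acts continuously and vertex-transitively, with a vertex $v\in\Gamma$, such that $d_S\asymp d_{\Gamma,v}$. (5) If the action is quasi-continuous and, further, metrically coarsely proper, then $S$ is coarsely bounded in $G$, so that $\widehat{d_S}$ is a geometry for $G$ (that is, a maximum element of $\mathrm{PMet}(G)$ with respect to $\succeq$). If in addition $G$ is non-Archimedean, then the graph $\Gamma$ of (4) is a Cayley–Abels–Rosendal graph for $G$ as soon as it is countable.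
   Context: Topological groups are not assumed Hausdorff. An identity neighborhood is a subset containing $1$ in its interior. A topological group is non-Archimedean if it has a neighborhood basis of the identity consisting of open subgroups. Pseudometrics. A pseudometric satisfies all axioms of a metric except that distinct points may have distance $0$. $\mathrm{PMet}(G)$ is the set of continuous, left-invariant pseudometrics $d:G\times G\to\mathbb{R}$. For left-invariant pseudometrics $d,d'$ on $G$ (continuous or not), $d\succeq d'$ ("$d$ dominates $d'$") means the identity map $(G,d)\to(G,d')$ is coarse Lipschitz: there are $L>0$, $K\ge 0$ with $d'(g,h)\le L\,d(g,h)+K$ for all $g,h\in G$. $d\asymp d'$ means $d\succeq d'$ and $d'\succeq d$; equivalently the identity map is a quasi-isometry. For an isometric action of $G$ on a metric space $(X,d_X)$ and $x\in X$, the orbit pseudometric is $d_{X,x}(g,h)=d_X(g.x,h.x)$. For a generating set $S$ of $G$, the word metric $d_S(g,h)$ is the least length of a word in $S\cup S^{-1}$ representing $g^{-1}h$. Actions. The action is cobounded if there is $R>0$ with $G.B_R(x)=X$, where $B_R(x)$ is the ball of radius $R$ about $x$. An isometric action is quasi-continuous if there is $\varepsilon>0$ such that for each $y\in X$ there is an identity neighborhood $U_y\subset G$ with $d_X(y,g.y)\le\varepsilon$ for all $g\in U_y$. A subset $A\subset G$ is coarsely bounded in $G$ if it has finite $d$-diameter for every $d\in\mathrm{PMet}(G)$. The action is metrically coarsely proper if for every $R>0$ and $y\in X$ the set $\{g\in G: g.B_R(y)\cap B_R(y)\ne\emptyset\}$ is coarsely bounded in $G$. A metric space is geodesic if any two points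 $p,q$ are joined by a rectifiable curve of length $d(p,q)$. Graphs. Connected graphs are simplicial, carry the path metric with edges of length $1$, and groups act on them by graph automorphisms; such an action is continuous if and only if all vertex stabilizers are open. A Cayley–Abels–Rosendal graph for $G$ is a connected, countable graph on which $G$ acts continuously, vertex-transitively, with finitely many orbits of edges and with vertex stabilizers coarsely bounded in $G$. *)

theory Defs
  imports "HOL-Analysis.Analysis"
begin

text \<open>
  Topological groups are types of class \<open>topological_group_add\<close>: the group is written
  additively as in the class hierarchy, but it is neither assumed commutative nor Hausdorff.
  So \<open>0\<close> is the identity and \<open>- g + h\<close> stands for the product of the inverse of
  \<open>g\<close> with \<open>h\<close>.
\<close>

subsection \<open>Subgroups, generating sets, non-Archimedean groups\<close>

definition add_subgroup :: "'g::group_add set \<Rightarrow> bool" where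
  "add_subgroup H \<longleftrightarrow> 0 \<in> H \<and> (\<forall>g\<in>H. \<forall>h\<in>H. g + h \<in> H) \<and> (\<forall>g\<in>H. - g \<in> H)"

definition generating_set :: "'g::group_add set \<Rightarrow> bool" where
  "generating_set S \<longleftrightarrow> add_subgroup hull S = UNIV"

definition identity_neighborhood :: "'g::topological_group_add set \<Rightarrow> bool" where
  "identity_neighborhood U \<longleftrightarrow> 0 \<in> interior U"

definition non_archimedean :: "'g::topological_group_add itself \<Rightarrow> bool" where
  "non_archimedean (_ :: 'g itself) \<longleftrightarrow>
     (\<forall>U::'g set. identity_neighborhood U \<longrightarrow> (\<exists>H. add_subgroup H \<and> open H \<and> H \<subseteq> U))"

subsection \<open>Pseudometrics\<close>

definition pseudometric :: "('a \<Rightarrow> 'a \<Rightarrow> real) \<Rightarrow> bool" where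
  "pseudometric d \<longleftrightarrow>
     (\<forall>x y. 0 \<le> d x y) \<and> (\<forall>x. d x x = 0) \<and> (\<forall>x y. d x y = d y x) \<and>
     (\<forall>x y z. d x z \<le> d x y + d y z)"

definition left_invariant :: "('g::group_add \<Rightarrow> 'g \<Rightarrow> real) \<Rightarrow> bool" where
  "left_invariant d \<longleftrightarrow> (\<forall>k g h. d (k + g) (k + h) = d g h)"

definition PMet :: "('g::topological_group_add \<Rightarrow> 'g \<Rightarrow> real) set" where
  "PMet = {d. pseudometric d \<and> left_invariant d \<and> continuous_on UNIV (\<lambda>(g, h). d g h)}"

definition dominates :: "('g \<Rightarrow> 'g \<Rightarrow> real) \<Rightarrow> ('g \<Rightarrow> 'g \<Rightarrow> real) \<Rightarrow> bool"
    (infix \<open>\<succeq>\<close> 50) where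
  "d \<succeq> d' \<longleftrightarrow> (\<exists>L>0. \<exists>K\<ge>0. \<forall>g h. d' g h \<le> L * d g h + K)"

definition equivalent :: "('g \<Rightarrow> 'g \<Rightarrow> real) \<Rightarrow> ('g \<Rightarrow> 'g \<Rightarrow> real) \<Rightarrow> bool"
    (infix \<open>\<asymp>\<close> 50) where
  "d \<asymp> d' \<longleftrightarrow> d \<succeq> d' \<and> d' \<succeq> d"

definition orbit_pseudometric ::
    "('g \<Rightarrow> 'x \<Rightarrow> 'x) \<Rightarrow> ('x \<Rightarrow> 'x \<Rightarrow> real) \<Rightarrow> 'x \<Rightarrow> 'g \<Rightarrow> 'g \<Rightarrow> real" where
  "orbit_pseudometric act d x g h = d (act g x) (act h x)"

text \<open>The value of \<open>word_metric\<close> is only meaningful when \<open>S\<close> is a generating set.\<close>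

definition word_metric :: "'g::group_add set \<Rightarrow> 'g \<Rightarrow> 'g \<Rightarrow> real" where
  "word_metric S g h =
     real (LEAST n. \<exists>w. set w \<subseteq> S \<union> uminus ` S \<and> length w = n \<and> sum_list w = - g + h)"

definition coarsely_bounded :: "'g::topological_group_add set \<Rightarrow> bool" where
  "coarsely_bounded A \<longleftrightarrow> (\<forall>d\<in>PMet. \<exists>C. \<forall>g\<in>A. \<forall>h\<in>A. d g h \<le> C)"

definition geometry :: "('g::topological_group_add \<Rightarrow> 'g \<Rightarrow> real) \<Rightarrow> bool" where
  "geometry d \<longleftrightarrow> d \<in> PMet \<and> (\<forall>d'\<in>PMet. d \<succeq> d')"

subsection \<open>Isometric actions on metric spaces\<close>

definition group_action_on :: "('g::group_add \<Rightarrow> 'x \<Rightarrow> 'x) \<Rightarrow> 'x set \<Rightarrow> bool" where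
  "group_action_on act X \<longleftrightarrow>
     (\<forall>g. \<forall>x\<in>X. act g x \<in> X) \<and> (\<forall>x\<in>X. act 0 x = x) \<and>
     (\<forall>g h. \<forall>x\<in>X. act (g + h) x = act g (act h x))"

definition isometric_action :: "('g::group_add \<Rightarrow> 'x::metric_space \<Rightarrow> 'x) \<Rightarrow> bool" where
  "isometric_action act \<longleftrightarrow>
     group_action_on act UNIV \<and> (\<forall>g y z. dist (act g y) (act g z) = dist y z)"

definition cobounded :: "('g::group_add \<Rightarrow> 'x::metric_space \<Rightarrow> 'x) \<Rightarrow> bool" where
  "cobounded act \<longleftrightarrow> (\<exists>y. \<exists>R>0. (\<Union>g. act g ` ball y R) = UNIV)"

definition quasi_continuous ::
    "('g::topological_group_add \<Rightarrow> 'x::metric_space \<Rightarrow> 'x) \<Rightarrow> bool" where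
  "quasi_continuous act \<longleftrightarrow>
     (\<exists>\<epsilon>>0. \<forall>y. \<exists>U. identity_neighborhood U \<and> (\<forall>g\<in>U. dist y (act g y) \<le> \<epsilon>))"

definition metrically_coarsely_proper ::
    "('g::topological_group_add \<Rightarrow> 'x::metric_space \<Rightarrow> 'x) \<Rightarrow> bool" where
  "metrically_coarsely_proper act \<longleftrightarrow>
     (\<forall>R>0. \<forall>y. coarsely_bounded {g. act g ` ball y R \<inter> ball y R \<noteq> {}})"

subsection \<open>Geodesic spaces\<close>

definition curve_length :: "(real \<Rightarrow> 'x::metric_space) \<Rightarrow> ereal" where
  "curve_length \<gamma> =
     (SUP (n, t) \<in> {(n::nat, t). mono_on {..n} t \<and> t ` {..n} \<subseteq> {0..1}}.
        ereal (\<Sum>i<n. dist (\<gamma> (t i)) (\<gamma> (t (Suc i)))))"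

text \<open>Rectifiability of \<open>\<gamma>\<close> is implied, as its length is required to be a real number.\<close>

definition geodesic_space :: "'x::metric_space itself \<Rightarrow> bool" where
  "geodesic_space (_ :: 'x itself) \<longleftrightarrow>
     (\<forall>p q :: 'x. \<exists>\<gamma>. path \<gamma> \<and> pathstart \<gamma> = p \<and> pathfinish \<gamma> = q \<and>
        curve_length \<gamma> = ereal (dist p q))"

subsection \<open>Graphs\<close>

definition simple_graph :: "'v set \<Rightarrow> 'v set set \<Rightarrow> bool" where
  "simple_graph V E \<longleftrightarrow> E \<subseteq> {{u, w} |u w. u \<in> V \<and> w \<in> V \<and> u \<noteq> w}"

definition walk :: "'v set \<Rightarrow> 'v set set \<Rightarrow> 'v list \<Rightarrow> 'v \<Rightarrow> 'v \<Rightarrow> bool" where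
  "walk V E p u w \<longleftrightarrow>
     p \<noteq> [] \<and> set p \<subseteq> V \<and> hd p = u \<and> last p = w \<and> successively (\<lambda>a b. {a, b} \<in> E) p"

definition connected_graph :: "'v set \<Rightarrow> 'v set set \<Rightarrow> bool" where
  "connected_graph V E \<longleftrightarrow>
     simple_graph V E \<and> V \<noteq> {} \<and> (\<forall>u\<in>V. \<forall>w\<in>V. \<exists>p. walk V E p u w)"

text \<open>The path metric (edges of length 1) on the vertices of a connected graph.\<close>

definition graph_dist :: "'v set \<Rightarrow> 'v set set \<Rightarrow> 'v \<Rightarrow> 'v \<Rightarrow> real" where
  "graph_dist V E u w = real (LEAST n. \<exists>p. walk V E p u w \<and> length p = Suc n)"

definition graph_action ::
    "('g::group_add \<Rightarrow> 'v \<Rightarrow> 'v) \<Rightarrow> 'v set \<Rightarrow> 'v set set \<Rightarrow> bool" where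
  "graph_action act V E \<longleftrightarrow>
     group_action_on act V \<and>
     (\<forall>g. \<forall>u\<in>V. \<forall>w\<in>V. {act g u, act g w} \<in> E \<longleftrightarrow> {u, w} \<in> E)"

text \<open>
  The path metric induces the discrete topology on the vertex set, and an action by graph
  automorphisms is continuous on the whole graph if and only if it is continuous on the vertices.
\<close>

definition continuous_graph_action ::
    "('g::topological_group_add \<Rightarrow> 'v \<Rightarrow> 'v) \<Rightarrow> 'v set \<Rightarrow> 'v set set \<Rightarrow> bool" where
  "continuous_graph_action act V E \<longleftrightarrow>
     graph_action act V E \<and>
     continuous_map (prod_topology euclidean (discrete_topology V)) (discrete_topology V)
       (\<lambda>(g, u). act g u)"

definition stabilizer :: "('g \<Rightarrow> 'v \<Rightarrow> 'v) \<Rightarrow> 'v \<Rightarrow> 'g set" where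
  "stabilizer act v = {g. act g v = v}"

definition vertex_transitive :: "('g \<Rightarrow> 'v \<Rightarrow> 'v) \<Rightarrow> 'v set \<Rightarrow> bool" where
  "vertex_transitive act V \<longleftrightarrow> (\<forall>u\<in>V. \<forall>w\<in>V. \<exists>g. act g u = w)"

definition edge_orbits :: "('g \<Rightarrow> 'v \<Rightarrow> 'v) \<Rightarrow> 'v set set \<Rightarrow> 'v set set set" where
  "edge_orbits act E = (\<lambda>e. range (\<lambda>g. act g ` e)) ` E"

definition Cayley_Abels_Rosendal_graph ::
    "('g::topological_group_add \<Rightarrow> 'v \<Rightarrow> 'v) \<Rightarrow> 'v set \<Rightarrow> 'v set set \<Rightarrow> bool" where
  "Cayley_Abels_Rosendal_graph act V E \<longleftrightarrow>
     connected_graph V E \<and> countable V \<and> continuous_graph_action act V E \<and>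
     vertex_transitive act V \<and> finite (edge_orbits act E) \<and>
     (\<forall>v\<in>V. coarsely_bounded (stabilizer act v))"

lemma continuous_graph_action_iff_open_stabilizers:
  fixes act :: "'g::topological_group_add \<Rightarrow> 'v \<Rightarrow> 'v"
  shows "continuous_graph_action act V E \<longleftrightarrow>
           graph_action act V E \<and> (\<forall>v\<in>V. open (stabilizer act v))"
proof (cases "graph_action act V E")
  case True
  then have cl: "\<And>g x. x \<in> V \<Longrightarrow> act g x \<in> V" and a0: "\<And>x. x \<in> V \<Longrightarrow> act 0 x = x"
    and ap: "\<And>g h x. x \<in> V \<Longrightarrow> act (g + h) x = act g (act h x)"
    by (auto simp: graph_action_def group_action_on_def)
  let ?P = "prod_topology (euclidean :: 'g topology) (discrete_topology V)"
  have "open (stabilizer act v)"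
    if c: "continuous_map ?P (discrete_topology V) (\<lambda>(g, u). act g u)" and v: "v \<in> V" for v
  proof -
    have "continuous_map euclidean ?P (\<lambda>g::'g. (g, v))"
      using v by (simp add: continuous_map_pairwise o_def)
    from continuous_map_compose[OF this c]
    have "continuous_map euclidean (discrete_topology V) (\<lambda>g. act g v)"
      by (simp add: o_def)
    then have "openin euclidean {g \<in> topspace euclidean. act g v \<in> {v}}"
      by (rule openin_continuous_map_preimage) (use v in auto)
    then show ?thesis
      by (simp add: stabilizer_def)
  qed
  moreover have "continuous_map ?P (discrete_topology V) (\<lambda>(g, u). act g u)"
    if o: "\<forall>v\<in>V. open (stabilizer act v)"
  proof (rule continuous_map_atin[THEN iffD2], intro ballI)
    fix x :: "'g \<times> 'v" assume "x \<in> topspace ?P"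
    then obtain g u where x: "x = (g, u)" and u: "u \<in> V" by auto
    let ?N = "(\<lambda>k. - g + k) -` stabilizer act u \<times> {u}"
    have "open ((\<lambda>k. - g + k) -` stabilizer act u)"
      using o u by (intro open_vimage) (auto intro!: continuous_intros)
    then have N: "openin ?P ?N" using u by (simp add: openin_prod_Times_iff)
    have xN: "x \<in> ?N" using a0 u by (simp add: x stabilizer_def)
    have con: "(\<lambda>(g, u). act g u) y = act g u" if "y \<in> ?N" for y
    proof -
      from that obtain k where y: "y = (k, u)" and k: "act (- g + k) u = u"
        by (auto simp: stabilizer_def)
      have "act k u = act (g + (- g + k)) u" by (simp add: add.assoc[symmetric])
      also have "\<dots> = act g u" using ap u k by metis
      finally show ?thesis using y by simp
    qed
    show "limitin (discrete_topology V) (\<lambda>(g, u). act g u) ((\<lambda>(g, u). act g u) x) (atin ?P x)"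
      unfolding limitin_def x prod.case
    proof (intro conjI allI impI)
      show "act g u \<in> topspace (discrete_topology V)" using cl u by simp
      fix W assume "openin (discrete_topology V) W \<and> act g u \<in> W"
      then show "\<forall>\<^sub>F y in atin ?P (g, u). (case y of (g, u) \<Rightarrow> act g u) \<in> W"
        using N xN con unfolding eventually_atin x by (metis (no_types, lifting) DiffD1)
    qed
  qed
  ultimately show ?thesis
    using True by (auto simp: continuous_graph_action_def)
qed (simp add: continuous_graph_action_def)

end

theory Submission
  imports Defs
begin

text \<open>
  The generating set is \<open>S = {g. dist x (g.x) \<le> r}\<close> for a large radius \<open>r\<close>. Coboundedness provides \<open>R\<close>
  such that the balls of radius \<open>R\<close> about the orbit of \<open>x\<close> cover \<open>X\<close>, and two such balls can only
  meet if their centres differ by an element of \<open>S\<close>, as soon as \<open>r \<ge> 2 * R\<close>. The balls about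
  the orbit of the subgroup generated by \<open>S\<close> therefore form a set that is open, as is its complement, so
  connectedness forces this subgroup to be everything (\<open>generating_set_displacement_le\<close>). Elements of
  \<open>S\<close> move \<open>x\<close> by at most \<open>r\<close>, hence the word metric dominates the orbit pseudometric. In a geodesic
  space, which is in particular connected, one follows a geodesic in steps of length 1 and moves from
  each stop to a nearby orbit point; consecutive orbit points differ by elements of \<open>S\<close> if
  \<open>r \<ge> 2 * R + 1\<close>, so word length is at most linear in distance (\<open>geodesic_word_ball\<close>).

  If the action is quasi-continuous, then \<open>S\<close> is an identity neighborhood for large \<open>r\<close>. The word
  metric is replaced by a continuous pseudometric by a Birkhoff-Kakutani argument: in a decreasing
  sequence of neighborhoods starting with \<open>S\<close>, each of which contains all triple sums from the next, an
  element of the \<open>n\<close>-th neighborhood may be used as a letter of cost \<open>(1/2) ^ n\<close>. The cheapest word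
  defines the pseudometric. Light words stay in \<open>S\<close>, and cutting a word into light pieces bounds the
  word length by the cost (\<open>continuous_equivalent_of_word_metric\<close>).

  If moreover \<open>S\<close> contains an open subgroup \<open>H\<close>, then the word metric of \<open>T \<union> H\<close> is, up to
  quasi-isometry, the path metric of the graph on the left cosets of \<open>H\<close> whose edges are given by \<open>T\<close>.
  The choice \<open>T = S\<close> always gives a suitable graph, but it can have infinitely many orbits of
  edges. Suppose that \<open>S\<close> is coarsely bounded, which holds for metrically coarsely proper actions, and that
  the coset space is countable. Enumerate coset representatives and let the \<open>i\<close>-th one cost \<open>i + 1\<close>,
  while elements of \<open>H\<close> are free. This gives a continuous pseudometric; that \<open>S\<close> is bounded for it
  means that finitely many representatives \<open>F\<close> together with \<open>H\<close> yield all of \<open>S\<close> by words of bounded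
  length (\<open>coarsely_bounded_word_ball\<close>). So \<open>T = F\<close> gives the same coarse geometry and finitely
  many edge orbits.
\<close>

section \<open>Words and word metrics\<close>

definition word_ball :: "'g::group_add set \<Rightarrow> nat \<Rightarrow> 'g set" where
  "word_ball S n = {sum_list w |w. set w \<subseteq> S \<union> uminus ` S \<and> length w \<le> n}"

lemma sum_list_rev_uminus:
  fixes w :: "'g::group_add list"
  shows "sum_list (rev (map uminus w)) = - sum_list w"
  by (induction w) (simp_all add: minus_add)

lemma word_ball_mono: "m \<le> n \<Longrightarrow> a \<in> word_ball S m \<Longrightarrow> a \<in> word_ball S n"
  unfolding word_ball_def by (blast intro: le_trans)

lemma zero_in_word_ball: "0 \<in> word_ball S n"
  unfolding word_ball_def by (rule CollectI, rule exI[of _ "[]"]) simp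

lemma letter_in_word_ball: "a \<in> S \<Longrightarrow> a \<in> word_ball S 1"
  unfolding word_ball_def by (rule CollectI, rule exI[of _ "[a]"]) simp

lemma word_ball_add:
  assumes "a \<in> word_ball S m" "b \<in> word_ball S n"
  shows "a + b \<in> word_ball S (m + n)"
proof -
  from assms obtain v w where "set v \<subseteq> S \<union> uminus ` S" "length v \<le> m" "a = sum_list v"
    "set w \<subseteq> S \<union> uminus ` S" "length w \<le> n" "b = sum_list w"
    unfolding word_ball_def by blast
  then show ?thesis
    unfolding word_ball_def by (intro CollectI exI[of _ "v @ w"]) auto
qed

lemma word_ball_uminus:
  assumes "a \<in> word_ball S n"
  shows "- a \<in> word_ball S n"
proof -
  from assms obtain w where w: "set w \<subseteq> S \<union> uminus ` S" "length w \<le> n" "a = sum_list w"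
    unfolding word_ball_def by blast
  then have "set (rev (map uminus w)) \<subseteq> S \<union> uminus ` S" by force
  with w show ?thesis
    unfolding word_ball_def
    by (intro CollectI exI[of _ "rev (map uminus w)"]) (simp add: sum_list_rev_uminus)
qed

lemma add_subgroup_word_balls: "add_subgroup {g. \<exists>n. g \<in> word_ball S n}"
  unfolding add_subgroup_def using zero_in_word_ball word_ball_add word_ball_uminus by blast

lemma generating_set_iff_word_balls: "generating_set S \<longleftrightarrow> (\<forall>g. \<exists>n. g \<in> word_ball S n)"
proof
  assume S: "generating_set S"
  have "S \<subseteq> {g. \<exists>n. g \<in> word_ball S n}"
    using letter_in_word_ball by blast
  then have "add_subgroup hull S \<subseteq> {g. \<exists>n. g \<in> word_ball S n}"
    by (simp add: hull_minimal add_subgroup_word_balls)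
  then show "\<forall>g. \<exists>n. g \<in> word_ball S n"
    using S unfolding generating_set_def by blast
next
  assume *: "\<forall>g. \<exists>n. g \<in> word_ball S n"
  have "g \<in> H" if H: "add_subgroup H" "S \<subseteq> H" for g H
  proof -
    from * obtain w where w: "set w \<subseteq> S \<union> uminus ` S" "g = sum_list w"
      unfolding word_ball_def by blast
    have "S \<union> uminus ` S \<subseteq> H" using H unfolding add_subgroup_def by blast
    with w(1) have "set w \<subseteq> H" by blast
    then have "sum_list w \<in> H"
      using H(1) by (induction w) (auto simp: add_subgroup_def)
    with w show ?thesis by simp
  qed
  then show "generating_set S"
    unfolding generating_set_def hull_def by blast
qed

lemma generating_set_by_word_ball:
  assumes "generating_set S" "S \<subseteq> word_ball T n"
  shows "generating_set T"
proof -
  have "add_subgroup hull S \<subseteq> {g. \<exists>n. g \<in> word_ball T n}"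
    using assms(2) by (intro hull_minimal add_subgroup_word_balls) auto
  with assms(1) show ?thesis
    unfolding generating_set_iff_word_balls[of T] by (auto simp: generating_set_def)
qed

lemma word_metric_le:
  assumes "- g + h \<in> word_ball S n"
  shows "word_metric S g h \<le> real n"
proof -
  from assms obtain w where w: "set w \<subseteq> S \<union> uminus ` S" "length w \<le> n" "- g + h = sum_list w"
    unfolding word_ball_def by blast
  have "(LEAST n. \<exists>w. set w \<subseteq> S \<union> uminus ` S \<and> length w = n \<and> sum_list w = - g + h) \<le> length w"
    by (rule Least_le) (rule exI[of _ w], simp add: w)
  with w(2) show ?thesis unfolding word_metric_def by linarith
qed

lemma word_metric_attained:
  assumes "generating_set S"
  obtains n where "word_metric S g h = real n" "- g + h \<in> word_ball S n"
proof -
  let ?P = "\<lambda>n. \<exists>w. set w \<subseteq> S \<union> uminus ` S \<and> length w = n \<and> sum_list w = - g + h"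
  from assms obtain m where "- g + h \<in> word_ball S m"
    unfolding generating_set_iff_word_balls by blast
  then obtain u where u: "set u \<subseteq> S \<union> uminus ` S" "- g + h = sum_list u"
    unfolding word_ball_def by blast
  then have "?P (length u)" by (intro exI[of _ u]) simp
  then have "?P (LEAST n. ?P n)" by (rule LeastI)
  then obtain w where "set w \<subseteq> S \<union> uminus ` S" "length w = (LEAST n. ?P n)"
    "sum_list w = - g + h" by blast
  then have "- g + h \<in> word_ball S (LEAST n. ?P n)"
    unfolding word_ball_def by (intro CollectI exI[of _ w]) simp
  then show thesis
    by (intro that[of "LEAST n. ?P n"]) (simp_all add: word_metric_def)
qed

lemma pseudometric_word_metric:
  assumes S: "generating_set S"
  shows "pseudometric (word_metric S)"
proof -
  have sym: "word_metric S g h \<le> word_metric S h g" for g h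
  proof -
    obtain n where n: "word_metric S h g = real n" "- h + g \<in> word_ball S n"
      using S by (rule word_metric_attained)
    from word_ball_uminus[OF n(2)] have "- g + h \<in> word_ball S n" by (simp add: minus_add)
    with n(1) show ?thesis using word_metric_le by metis
  qed
  have tri: "word_metric S g k \<le> word_metric S g h + word_metric S h k" for g h k
  proof -
    obtain m where m: "word_metric S g h = real m" "- g + h \<in> word_ball S m"
      using S by (rule word_metric_attained)
    obtain n where n: "word_metric S h k = real n" "- h + k \<in> word_ball S n"
      using S by (rule word_metric_attained)
    have "- g + k = (- g + h) + (- h + k)" by (simp add: add.assoc)
    then have "- g + k \<in> word_ball S (m + n)" using word_ball_add m(2) n(2) by metis
    then show ?thesis using word_metric_le m(1) n(1) by (metis of_nat_add)
  qed
  have "word_metric S g g = 0" for g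
    using word_metric_le[of g g S 0] zero_in_word_ball[of S 0] by (simp add: word_metric_def)
  then show ?thesis
    unfolding pseudometric_def using sym tri by (auto simp: word_metric_def intro: antisym)
qed

lemma left_invariant_word_metric: "left_invariant (word_metric S)"
proof -
  have "- (k + g) + (k + h) = - g + h" for k g h :: 'a
    by (simp add: minus_add add.assoc del: add_uminus_conv_diff)
  then show ?thesis
    unfolding left_invariant_def word_metric_def by presburger
qed

lemma left_invariant_0:
  assumes "left_invariant d"
  shows "d g h = d 0 (- g + h)"
  using assms unfolding left_invariant_def by (metis add.left_inverse)

text \<open>
  Domination is only a matter of the generators: a left-invariant pseudometric grows along a word by
  at most its largest value on letters.
\<close>

lemma word_metric_dominates:
  assumes S: "generating_set S" and d: "pseudometric d" "left_invariant d"
    and C: "\<And>s. s \<in> S \<Longrightarrow> d 0 s \<le> C"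
  shows "word_metric S \<succeq> d"
proof -
  \<comment> \<open>domination asks for a positive factor, which \<open>C\<close> need not be\<close>
  define L where "L = max C 1"
  have d0: "d 0 0 = 0" and sym: "d a b = d b a" and tri: "d a c \<le> d a b + d b c" for a b c
    using d(1) unfolding pseudometric_def by auto
  have inv: "d (k + a) (k + b) = d a b" for k a b
    using d(2) unfolding left_invariant_def by blast
  have L: "d 0 a \<le> L" if "a \<in> S \<union> uminus ` S" for a
  proof -
    have "d 0 (- s) = d 0 s" for s
      using inv[of s 0 "- s"] sym by simp
    with that C show ?thesis unfolding L_def by force
  qed
  have word: "d 0 (sum_list w) \<le> L * length w" if "set w \<subseteq> S \<union> uminus ` S" for w
    using that
  proof (induction w)
    case (Cons a w)
    have "d 0 (sum_list (a # w)) \<le> d 0 a + d a (a + sum_list w)" using tri by simp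
    also have "d a (a + sum_list w) = d 0 (sum_list w)" using inv[of a 0] by simp
    also have "d 0 a + d 0 (sum_list w) \<le> L + L * length w"
      using Cons L by (intro add_mono) auto
    finally show ?case by (simp add: algebra_simps)
  qed (simp add: d0)
  have "d g h \<le> L * word_metric S g h + 0" for g h
  proof -
    obtain n where n: "word_metric S g h = real n" "- g + h \<in> word_ball S n"
      using S by (rule word_metric_attained)
    then obtain w where w: "set w \<subseteq> S \<union> uminus ` S" "length w \<le> n" "- g + h = sum_list w"
      unfolding word_ball_def by blast
    have "d g h = d 0 (sum_list w)" using left_invariant_0[OF d(2)] w(3) by metis
    also have "\<dots> \<le> L * length w" by (rule word[OF w(1)])
    also have "\<dots> \<le> L * real n" using w(2) by (intro mult_left_mono) (auto simp: L_def)
    finally show ?thesis using n(1) by simp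
  qed
  moreover have "L > 0" unfolding L_def by simp
  ultimately show ?thesis unfolding dominates_def by blast
qed

lemma word_metric_dominates_word_metric:
  assumes "generating_set S" "generating_set T" "S \<subseteq> word_ball T n"
  shows "word_metric S \<succeq> word_metric T"
proof (rule word_metric_dominates)
  show "word_metric T 0 s \<le> real n" if "s \<in> S" for s
    using that assms(3) by (intro word_metric_le) auto
qed (use assms in \<open>auto intro: pseudometric_word_metric left_invariant_word_metric\<close>)

lemma dominates_trans:
  assumes "d \<succeq> d'" "d' \<succeq> d''"
  shows "d \<succeq> d''"
proof -
  from assms obtain L K L' K' where L: "L > 0" "K \<ge> 0" "\<And>g h. d' g h \<le> L * d g h + K"
    and L': "L' > 0" "K' \<ge> 0" "\<And>g h. d'' g h \<le> L' * d' g h + K'"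
    unfolding dominates_def by metis
  have "d'' g h \<le> (L' * L) * d g h + (L' * K + K')" for g h
  proof -
    have "L' * d' g h \<le> L' * (L * d g h + K)" using L L' by (intro mult_left_mono) auto
    with L'(3)[of g h] show ?thesis by (simp add: algebra_simps)
  qed
  then show ?thesis unfolding dominates_def using L L'
    by (intro exI[of _ "L' * L"] conjI exI[of _ "L' * K + K'"]) auto
qed

lemma equivalent_trans: "d \<asymp> d' \<Longrightarrow> d' \<asymp> d'' \<Longrightarrow> d \<asymp> d''"
  unfolding equivalent_def using dominates_trans by blast

section \<open>Pseudometrics from weighted words\<close>

text \<open>
  A pair \<open>(a, c)\<close> in \<open>Q\<close> stands for a letter \<open>a\<close> that can be used at cost \<open>c\<close>. The same letter may
  have several costs, so no cost function has to be chosen; the infimum takes care of it.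
\<close>

definition weighted_pseudometric :: "('g::group_add \<times> real) set \<Rightarrow> 'g \<Rightarrow> 'g \<Rightarrow> real" where
  "weighted_pseudometric Q g h =
     Inf {sum_list (map snd w) |w. set w \<subseteq> Q \<and> sum_list (map fst w) = - g + h}"

locale weighted_letters =
  fixes Q :: "('g::group_add \<times> real) set"
  assumes nonneg: "(a, c) \<in> Q \<Longrightarrow> 0 \<le> c"
    and symmetric: "(a, c) \<in> Q \<Longrightarrow> (- a, c) \<in> Q"
    and generating: "\<exists>w. set w \<subseteq> Q \<and> sum_list (map fst w) = g"
begin

lemma weight_nonneg: "set w \<subseteq> Q \<Longrightarrow> 0 \<le> sum_list (map snd w)"
  by (rule sum_list_nonneg) (use nonneg in auto)

lemma weighted_pseudometric_le:
  assumes "set w \<subseteq> Q" "sum_list (map fst w) = - g + h"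
  shows "weighted_pseudometric Q g h \<le> sum_list (map snd w)"
  unfolding weighted_pseudometric_def
proof (rule cInf_lower)
  show "bdd_below {sum_list (map snd w) |w. set w \<subseteq> Q \<and> sum_list (map fst w) = - g + h}"
    by (rule bdd_belowI[of _ 0]) (use weight_nonneg in auto)
qed (use assms in blast)

lemma weighted_pseudometric_less:
  assumes "weighted_pseudometric Q g h < c"
  obtains w where "set w \<subseteq> Q" "sum_list (map fst w) = - g + h" "sum_list (map snd w) < c"
proof -
  have "{sum_list (map snd w) |w. set w \<subseteq> Q \<and> sum_list (map fst w) = - g + h} \<noteq> {}"
    using generating by blast
  from cInf_lessD[OF this assms[unfolded weighted_pseudometric_def]] that show thesis
    by blast
qed

lemma weighted_pseudometric_ge:
  assumes "\<And>w. set w \<subseteq> Q \<Longrightarrow> sum_list (map fst w) = - g + h \<Longrightarrow> c \<le> sum_list (map snd w)"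
  shows "c \<le> weighted_pseudometric Q g h"
proof (rule ccontr)
  assume "\<not> c \<le> weighted_pseudometric Q g h"
  then have "weighted_pseudometric Q g h < c" by simp
  then obtain w where "set w \<subseteq> Q" "sum_list (map fst w) = - g + h" "sum_list (map snd w) < c"
    by (rule weighted_pseudometric_less)
  with assms[of w] show False by simp
qed

lemma left_invariant_weighted: "left_invariant (weighted_pseudometric Q)"
proof -
  have "- (k + g) + (k + h) = - g + h" for k g h :: 'g
    by (simp add: minus_add add.assoc del: add_uminus_conv_diff)
  then show ?thesis
    unfolding left_invariant_def weighted_pseudometric_def by presburger
qed

lemma pseudometric_weighted: "pseudometric (weighted_pseudometric Q)"
proof -
  let ?d = "weighted_pseudometric Q"
  have nn: "0 \<le> ?d g h" for g h
    by (rule weighted_pseudometric_ge) (rule weight_nonneg)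
  have refl: "?d g g = 0" for g
    using weighted_pseudometric_le[of "[]" g g] nn[of g g] by simp
  have sym: "?d g h \<le> ?d h g" for g h
  proof (rule weighted_pseudometric_ge)
    fix w assume w: "set w \<subseteq> Q" "sum_list (map fst w) = - h + g"
    let ?v = "rev (map (\<lambda>(a, c). (- a, c)) w)"
    have "map fst ?v = rev (map uminus (map fst w))"
      by (simp add: rev_map o_def split_def)
    then have "sum_list (map fst ?v) = - (- h + g)"
      using w(2) sum_list_rev_uminus by metis
    then have "sum_list (map fst ?v) = - g + h" by (simp add: minus_add)
    moreover have "set ?v \<subseteq> Q" using w(1) symmetric by auto
    moreover have "map snd ?v = rev (map snd w)" by (simp add: rev_map o_def split_def)
    then have "sum_list (map snd ?v) = sum_list (map snd w)" by (simp add: sum_list_rev)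
    ultimately show "?d g h \<le> sum_list (map snd w)" using weighted_pseudometric_le by metis
  qed
  have tri: "?d g k \<le> ?d g h + ?d h k" for g h k
  proof (rule field_le_epsilon)
    fix e :: real assume e: "0 < e"
    obtain v where v: "set v \<subseteq> Q" "sum_list (map fst v) = - g + h"
      "sum_list (map snd v) < ?d g h + e/2"
      using weighted_pseudometric_less[of g h "?d g h + e/2"] e by auto
    obtain w where w: "set w \<subseteq> Q" "sum_list (map fst w) = - h + k"
      "sum_list (map snd w) < ?d h k + e/2"
      using weighted_pseudometric_less[of h k "?d h k + e/2"] e by auto
    have "sum_list (map fst (v @ w)) = - g + k" using v(2) w(2) by (simp add: add.assoc)
    then have "?d g k \<le> sum_list (map snd (v @ w))"
      using v(1) w(1) by (intro weighted_pseudometric_le) auto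
    with v(3) w(3) show "?d g k \<le> ?d g h + ?d h k + e" by simp
  qed
  show ?thesis
    unfolding pseudometric_def using nn refl sym tri by (auto intro: antisym)
qed

lemma weighted_pseudometric_letter: "(a, c) \<in> Q \<Longrightarrow> weighted_pseudometric Q 0 a \<le> c"
  using weighted_pseudometric_le[of "[(a, c)]" 0 a] by simp

end

text \<open>
  For a left-invariant pseudometric, continuity at the identity suffices: translation carries it to
  every point, and the triangle inequality to both arguments.
\<close>

lemma PMet_I:
  fixes d :: "'g::topological_group_add \<Rightarrow> 'g \<Rightarrow> real"
  assumes "pseudometric d" "left_invariant d"
    and small: "\<And>e. e > 0 \<Longrightarrow> \<exists>U. identity_neighborhood U \<and> (\<forall>g\<in>U. d 0 g \<le> e)"
  shows "d \<in> PMet"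
proof -
  have sym: "d a b = d b a" and tri: "d a c \<le> d a b + d b c" for a b c
    using assms(1) unfolding pseudometric_def by auto
  have near: "\<forall>\<^sub>F k in nhds g. d g k \<le> e" if e: "e > 0" for g :: 'g and e
  proof -
    obtain U where U: "identity_neighborhood U" "\<forall>g\<in>U. d 0 g \<le> e" using small[OF e] by blast
    have "((\<lambda>k. - g + k) \<longlongrightarrow> - g + g) (nhds g)"
      by (intro tendsto_intros filterlim_ident)
    then have "((\<lambda>k. - g + k) \<longlongrightarrow> 0) (nhds g)" by simp
    then have "\<forall>\<^sub>F k in nhds g. - g + k \<in> interior U"
      by (rule topological_tendstoD) (use U in \<open>auto simp: identity_neighborhood_def\<close>)
    then show ?thesis
    proof (rule eventually_mono)
      fix k assume "- g + k \<in> interior U"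
      then have "d 0 (- g + k) \<le> e" using U(2) interior_subset by blast
      then show "d g k \<le> e" using left_invariant_0[OF assms(2)] by metis
    qed
  qed
  have "continuous_on UNIV (\<lambda>(g, h). d g h)"
    unfolding continuous_on_def
  proof (intro ballI tendstoI)
    fix p :: "'g \<times> 'g" and e :: real assume e: "0 < e"
    obtain g h where p: "p = (g, h)" by fastforce
    have ev: "\<forall>\<^sub>F q in nhds p. d g (fst q) \<le> e/3 \<and> d h (snd q) \<le> e/3"
      unfolding p nhds_prod
      by (intro eventually_prodI[OF near[of "e/3" g] near[of "e/3" h]]) (use e in auto)
    have "\<forall>\<^sub>F q in nhds p. dist (case q of (g, h) \<Rightarrow> d g h) (case p of (g, h) \<Rightarrow> d g h) < e"
    proof (rule eventually_mono[OF ev])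
      fix q assume q: "d g (fst q) \<le> e/3 \<and> d h (snd q) \<le> e/3"
      obtain g' h' where q': "q = (g', h')" by fastforce
      have "d g' h' \<le> d g' g + (d g h + d h h')" "d g h \<le> d g g' + (d g' h' + d h' h)"
        using tri[of g' h' g] tri[of g h' h] tri[of g h g'] tri[of g' h h'] by linarith+
      moreover have "d g g' \<le> e/3" "d h h' \<le> e/3" using q by (simp_all add: q')
      ultimately have "\<bar>d g' h' - d g h\<bar> < e"
        using e sym[of g g'] sym[of h h'] by linarith
      then show "dist (case q of (g, h) \<Rightarrow> d g h) (case p of (g, h) \<Rightarrow> d g h) < e"
        by (simp add: p q' dist_real_def)
    qed
    then show "\<forall>\<^sub>F q in at p within UNIV.
        dist (case q of (g, h) \<Rightarrow> d g h) (case p of (g, h) \<Rightarrow> d g h) < e"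
      by (simp add: eventually_at_filter eventually_mono)
  qed
  with assms show ?thesis unfolding PMet_def by simp
qed

section \<open>A continuous replacement for the word metric\<close>

lemma identity_neighborhood_halving:
  fixes U :: "'g::topological_group_add set"
  assumes "identity_neighborhood U"
  obtains A where "open A" "0 \<in> A" "\<And>a b. a \<in> A \<Longrightarrow> b \<in> A \<Longrightarrow> a + b \<in> U"
proof -
  have "continuous_on UNIV (\<lambda>p::'g \<times> 'g. fst p + snd p)"
    by (intro continuous_intros)
  then have "open ((\<lambda>p::'g \<times> 'g. fst p + snd p) -` interior U)"
    by (rule open_vimage[OF open_interior])
  moreover have "(0, 0) \<in> (\<lambda>p::'g \<times> 'g. fst p + snd p) -` interior U"
    using assms by (simp add: identity_neighborhood_def)
  ultimately obtain A B where AB: "open A" "open B" "(0, 0) \<in> A \<times> B"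
    "A \<times> B \<subseteq> (\<lambda>p::'g \<times> 'g. fst p + snd p) -` interior U"
    by (rule open_prod_elim)
  show thesis
  proof (rule that[of "A \<inter> B"])
    fix a b assume "a \<in> A \<inter> B" "b \<in> A \<inter> B"
    then have "(a, b) \<in> A \<times> B" by simp
    then show "a + b \<in> U" using AB(4) interior_subset by fastforce
  qed (use AB in auto)
qed

text \<open>
  One step in the construction of a Birkhoff-Kakutani sequence: continuity of addition is used twice,
  and then the neighborhood is made symmetric.
\<close>

lemma identity_neighborhood_cube_root:
  fixes U :: "'g::topological_group_add set"
  assumes "identity_neighborhood U"
  shows "\<exists>W. identity_neighborhood W \<and> uminus ` W \<subseteq> W \<and>
           (\<forall>a\<in>W. \<forall>b\<in>W. \<forall>c\<in>W. a + b + c \<in> U)"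
proof -
  obtain A where A: "open A" "0 \<in> A" "\<And>a b. a \<in> A \<Longrightarrow> b \<in> A \<Longrightarrow> a + b \<in> U"
    using assms by (rule identity_neighborhood_halving) blast
  have "identity_neighborhood A" using A by (simp add: identity_neighborhood_def interior_open)
  then obtain B where B: "open B" "0 \<in> B" "\<And>a b. a \<in> B \<Longrightarrow> b \<in> B \<Longrightarrow> a + b \<in> A"
    by (rule identity_neighborhood_halving) blast
  let ?W = "B \<inter> uminus -` B"
  have "open (uminus -` B)"
    by (rule open_vimage[OF B(1)]) (intro continuous_intros)
  then have "identity_neighborhood ?W"
    using B by (simp add: identity_neighborhood_def interior_open open_Int)
  moreover have "a + b + c \<in> U" if "a \<in> ?W" "b \<in> ?W" "c \<in> ?W" for a b c
    using that A(3)[of "a + b" c] B(3)[of a b] B(3)[of c 0] B(2) by auto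
  ultimately show ?thesis by (intro exI[of _ ?W]) auto
qed

text \<open>
  The letter \<open>a\<close> is the one at which the partial sums of the weights pass \<open>c\<close>.
\<close>

lemma split_list_at_weight:
  fixes f :: "'a \<Rightarrow> real"
  assumes "w \<noteq> []" "0 \<le> c" "c \<le> sum_list (map f w)"
  obtains u a v where "w = u @ a # v" "sum_list (map f u) \<le> c" "c \<le> sum_list (map f u) + f a"
proof -
  have "\<exists>u a v. w = u @ a # v \<and> sum_list (map f u) \<le> c \<and> c \<le> sum_list (map f u) + f a"
    using assms
  proof (induction w arbitrary: c)
    case (Cons x w)
    show ?case
    proof (cases "c \<le> f x")
      case True
      with Cons.prems show ?thesis by (intro exI[of _ "[]"] exI[of _ x] exI[of _ w]) simp
    next
      case False
      with Cons.prems have "w \<noteq> []" "0 \<le> c - f x" "c - f x \<le> sum_list (map f w)" by auto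
      from Cons.IH[OF this] obtain u a v where
        "w = u @ a # v" "sum_list (map f u) \<le> c - f x" "c - f x \<le> sum_list (map f u) + f a"
        by blast
      then show ?thesis by (intro exI[of _ "x # u"] exI[of _ a] exI[of _ v]) auto
    qed
  qed simp
  with that show thesis by blast
qed

text \<open>
  Kakutani's lemma. A word is cut at the letter where half of its total cost is reached. What is left
  of this letter and what is right of it cost less than \<open>(1/2) ^ Suc n\<close>, and the letter itself, costing less
  than \<open>(1/2) ^ n\<close>, costs at most \<open>(1/2) ^ Suc n\<close>; all three parts lie in \<open>W (Suc n)\<close>. Bounds on
  triple sums are needed because of the letter in the middle.
\<close>

lemma light_word_in_neighborhood:
  fixes W :: "nat \<Rightarrow> 'g::group_add set"
  assumes zero: "\<And>n. 0 \<in> W n"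
    and cube: "\<And>n a b c. a \<in> W (Suc n) \<Longrightarrow> b \<in> W (Suc n) \<Longrightarrow> c \<in> W (Suc n) \<Longrightarrow> a + b + c \<in> W n"
    and w: "set w \<subseteq> {(a, (1/2 :: real) ^ n) |a n. a \<in> W n}" "sum_list (map snd w) < (1/2) ^ n"
  shows "sum_list (map fst w) \<in> W n"
  using w
proof (induction "length w" arbitrary: w n rule: less_induct)
  case less
  have "W (Suc n) \<subseteq> W n" for n using cube[of _ n 0 0] zero by auto
  then have decr: "W m \<subseteq> W n" if "n \<le> m" for m n
    using that by (metis lift_Suc_antimono_le)
  have nonneg: "0 \<le> sum_list (map snd u)" if "set u \<subseteq> set w" for u
    by (rule sum_list_nonneg) (use that less.prems(1) in auto)
  show ?case
  proof (cases "w = []")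
    case False
    let ?s = "sum_list (map snd w)"
    have "0 \<le> ?s / 2" "?s / 2 \<le> ?s" using nonneg[of w] by auto
    then obtain u p v where w: "w = u @ p # v" and u: "sum_list (map snd u) \<le> ?s / 2"
      and up: "?s / 2 \<le> sum_list (map snd u) + snd p"
      by (rule split_list_at_weight[OF False])
    have s: "?s = sum_list (map snd u) + snd p + sum_list (map snd v)" by (simp add: w)
    have "sum_list (map fst u) \<in> W (Suc n)" "sum_list (map fst v) \<in> W (Suc n)"
      using less.prems u up s by (auto intro!: less.hyps simp: w)
    moreover have "fst p \<in> W (Suc n)"
    proof -
      obtain m where p: "fst p \<in> W m" "snd p = (1/2) ^ m" using less.prems(1) by (auto simp: w)
      have "set u \<subseteq> set w" "set v \<subseteq> set w" unfolding w by auto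
      then have "snd p \<le> ?s" using nonneg[of u] nonneg[of v] s by linarith
      then have "(1/2) ^ m < (1/2 :: real) ^ n" using less.prems(2) p(2) by linarith
      then have "n < m" by (simp add: power_strict_decreasing_iff)
      with p(1) decr[of "Suc n" m] show ?thesis by auto
    qed
    ultimately have "sum_list (map fst u) + fst p + sum_list (map fst v) \<in> W n"
      using cube by blast
    then show ?thesis by (simp add: w add.assoc)
  qed (use zero in simp)
qed

text \<open>
  Costs can be much smaller than word lengths, but a piece of cost less than 1 can be
  replaced by a single element of \<open>S\<close>. Repeatedly cutting off a piece of cost at most \<open>1/2\<close> followed by
  the next letter uses two elements of \<open>S\<close> for a cost of at least \<open>1/2\<close>, whence the factor 4.
\<close>

lemma merge_light_words:
  fixes Q :: "('g::group_add \<times> real) set"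
  assumes light: "\<And>w. set w \<subseteq> Q \<Longrightarrow> sum_list (map snd w) < 1 \<Longrightarrow> sum_list (map fst w) \<in> S"
    and letters: "fst ` Q \<subseteq> S" and nonneg: "\<And>p. p \<in> Q \<Longrightarrow> 0 \<le> snd p"
    and w: "set w \<subseteq> Q"
  shows "\<exists>n. sum_list (map fst w) \<in> word_ball S n \<and> real n \<le> 4 * sum_list (map snd w) + 1"
  using w
proof (induction "length w" arbitrary: w rule: less_induct)
  case less
  show ?case
  proof (cases "sum_list (map snd w) < 1")
    case True
    with less.prems have "sum_list (map fst w) \<in> word_ball S 1"
      by (intro letter_in_word_ball light)
    moreover have "0 \<le> sum_list (map snd w)"
      by (rule sum_list_nonneg) (use less.prems nonneg in auto)
    ultimately show ?thesis by (intro exI[of _ 1]) simp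
  next
    case False
    then have "w \<noteq> []" "0 \<le> (1/2 :: real)" "1/2 \<le> sum_list (map snd w)" by auto
    then obtain u p v where w: "w = u @ p # v" and u: "sum_list (map snd u) \<le> 1/2"
      and up: "1/2 \<le> sum_list (map snd u) + snd p"
      by (rule split_list_at_weight)
    have sub: "set u \<subseteq> Q" "p \<in> Q" "set v \<subseteq> Q" using less.prems by (auto simp: w)
    obtain n where n: "sum_list (map fst v) \<in> word_ball S n"
      "real n \<le> 4 * sum_list (map snd v) + 1"
      using less.hyps[of v] sub by (auto simp: w)
    have "sum_list (map fst u) \<in> word_ball S 1"
      using sub(1) u by (intro letter_in_word_ball light) auto
    moreover have "fst p \<in> word_ball S 1"
      using sub(2) letters by (intro letter_in_word_ball) auto
    ultimately have "sum_list (map fst u) + (fst p + sum_list (map fst v)) \<in> word_ball S (1 + (1 + n))"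
      using n(1) by (intro word_ball_add)
    then have "sum_list (map fst w) \<in> word_ball S (1 + (1 + n))" by (simp add: w)
    moreover have "real (1 + (1 + n)) \<le> 4 * sum_list (map snd w) + 1"
      using n(2) up by (simp add: w)
    ultimately show ?thesis by blast
  qed
qed

theorem continuous_equivalent_of_word_metric:
  fixes S :: "'g::topological_group_add set"
  assumes S: "generating_set S" "identity_neighborhood S" "uminus ` S \<subseteq> S"
  shows "\<exists>d\<in>PMet. d \<asymp> word_metric S"
proof -
  let ?P = "\<lambda>W::'g set. identity_neighborhood W \<and> uminus ` W \<subseteq> W"
  have "\<exists>W. \<forall>n. (?P (W n) \<and> (n = 0 \<longrightarrow> W n = S)) \<and>
      (\<forall>a\<in>W (Suc n). \<forall>b\<in>W (Suc n). \<forall>c\<in>W (Suc n). a + b + c \<in> W n)"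
  proof (rule dependent_nat_choice)
    show "\<exists>W. ?P W \<and> (0 = (0::nat) \<longrightarrow> W = S)" using S by blast
    show "\<exists>W'. (?P W' \<and> (Suc n = 0 \<longrightarrow> W' = S)) \<and>
        (\<forall>a\<in>W'. \<forall>b\<in>W'. \<forall>c\<in>W'. a + b + c \<in> W)"
      if "?P W \<and> (n = 0 \<longrightarrow> W = S)" for W n
      using identity_neighborhood_cube_root[of W] that by auto
  qed
  then obtain W where nbhd: "\<And>n. identity_neighborhood (W n)"
    and symW: "\<And>n. uminus ` W n \<subseteq> W n" and W0: "W 0 = S"
    and cube: "\<And>n a b c. a \<in> W (Suc n) \<Longrightarrow> b \<in> W (Suc n) \<Longrightarrow> c \<in> W (Suc n) \<Longrightarrow> a + b + c \<in> W n"
    by metis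
  have zero: "0 \<in> W n" for n
    using nbhd interior_subset unfolding identity_neighborhood_def by blast
  define Q where "Q = {(a, (1/2::real) ^ n) |a n. a \<in> W n}"
  \<comment> \<open>generators cost at most 1, so the new pseudometric is dominated by the word metric\<close>
  have SQ: "(a, 1) \<in> Q" if "a \<in> S" for a
    unfolding Q_def using that W0 by (intro CollectI exI[of _ a] exI[of _ 0]) simp
  have light: "sum_list (map fst w) \<in> S" if "set w \<subseteq> Q" "sum_list (map snd w) < 1" for w
    using light_word_in_neighborhood[of W w 0] zero cube that W0 unfolding Q_def by simp
  interpret weighted_letters Q
  proof
    show "0 \<le> c" if "(a, c) \<in> Q" for a c using that by (auto simp: Q_def)
    show "(- a, c) \<in> Q" if "(a, c) \<in> Q" for a c using that symW unfolding Q_def by blast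
    show "\<exists>w. set w \<subseteq> Q \<and> sum_list (map fst w) = g" for g
    proof -
      obtain w where w: "set w \<subseteq> S \<union> uminus ` S" "g = sum_list w"
        using S(1) unfolding generating_set_iff_word_balls word_ball_def by blast
      then have "set w \<subseteq> S" using S(3) by blast
      then have "set (map (\<lambda>a. (a, 1)) w) \<subseteq> Q" using SQ by auto
      with w(2) show ?thesis
        by (intro exI[of _ "map (\<lambda>a. (a, 1)) w"]) (simp add: o_def)
    qed
  qed
  let ?d = "weighted_pseudometric Q"
  have "?d \<in> PMet"
  proof (rule PMet_I[OF pseudometric_weighted left_invariant_weighted])
    fix e :: real assume "0 < e"
    then obtain n where n: "(1/2 :: real) ^ n < e" using real_arch_pow_inv[of e "1/2"] by auto
    have "?d 0 g \<le> e" if "g \<in> W n" for g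
      using weighted_pseudometric_letter[of g "(1/2) ^ n"] that n unfolding Q_def by force
    with nbhd show "\<exists>U. identity_neighborhood U \<and> (\<forall>g\<in>U. ?d 0 g \<le> e)" by blast
  qed
  moreover have "word_metric S \<succeq> ?d"
    by (rule word_metric_dominates[OF S(1) pseudometric_weighted left_invariant_weighted])
      (rule weighted_pseudometric_letter[OF SQ])
  moreover have "?d \<succeq> word_metric S"
  proof -
    have decr: "W n \<subseteq> W 0" for n
    proof -
      have "W (Suc n) \<subseteq> W n" for n using cube[of _ n 0 0] zero by auto
      then show ?thesis by (metis lift_Suc_antimono_le le0)
    qed
    then have letters: "fst ` Q \<subseteq> S" using W0 unfolding Q_def by fastforce
    have "word_metric S g h \<le> 4 * ?d g h + 1" for g h
    proof -
      have "(word_metric S g h - 1) / 4 \<le> ?d g h"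
      proof (rule weighted_pseudometric_ge)
        fix w assume w: "set w \<subseteq> Q" "sum_list (map fst w) = - g + h"
        have "\<exists>n. sum_list (map fst w) \<in> word_ball S n \<and> real n \<le> 4 * sum_list (map snd w) + 1"
          by (rule merge_light_words[OF _ _ _ w(1)]) (use light letters nonneg in auto)
        then obtain n where "- g + h \<in> word_ball S n" "real n \<le> 4 * sum_list (map snd w) + 1"
          using w(2) by auto
        with word_metric_le[of g h S n] show "(word_metric S g h - 1) / 4 \<le> sum_list (map snd w)"
          by auto
      qed
      then show ?thesis by simp
    qed
    then show ?thesis unfolding dominates_def
      by (intro exI[of _ 4] conjI exI[of _ 1]) auto
  qed
  ultimately show ?thesis unfolding equivalent_def by blast
qed

section \<open>Coset graphs\<close>

text \<open>
  The left cosets of \<open>H\<close> are the vertices, and the graph is the quotient by \<open>H\<close> of the Cayley graph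
  of \<open>T\<close>, without loops.
\<close>

definition translate :: "'g::group_add \<Rightarrow> 'g set \<Rightarrow> 'g set" where
  "translate g A = (+) g ` A"

definition coset_vertices :: "'g::group_add set \<Rightarrow> 'g set set" where
  "coset_vertices H = range (\<lambda>g. translate g H)"

definition coset_edges :: "'g::group_add set \<Rightarrow> 'g set \<Rightarrow> 'g set set set" where
  "coset_edges H T =
     {{A, B} |A B. A \<in> coset_vertices H \<and> B \<in> coset_vertices H \<and> A \<noteq> B \<and>
        (\<exists>a\<in>A. \<exists>b\<in>B. - a + b \<in> T)}"

lemma translate_translate: "translate g (translate h A) = translate (g + h) A"
  unfolding translate_def by (simp add: image_image add.assoc)

lemma translate_0: "translate 0 A = A"
  unfolding translate_def by simp

lemma mem_translate: "a \<in> translate g A \<longleftrightarrow> - g + a \<in> A"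
proof
  assume "- g + a \<in> A"
  then have "g + (- g + a) \<in> translate g A" unfolding translate_def by blast
  then show "a \<in> translate g A" by simp
qed (auto simp: translate_def)

lemma coset_edge_iff:
  "{A, B} \<in> coset_edges H T \<longleftrightarrow> A \<in> coset_vertices H \<and> B \<in> coset_vertices H \<and> A \<noteq> B \<and>
     (\<exists>a\<in>A. \<exists>b\<in>B. - a + b \<in> T \<union> uminus ` T)" (is "?l \<longleftrightarrow> ?r")
proof
  assume ?l
  then obtain A' B' a b where *: "{A, B} = {A', B'}" "A' \<in> coset_vertices H"
    "B' \<in> coset_vertices H" "A' \<noteq> B'" "a \<in> A'" "b \<in> B'" "- a + b \<in> T"
    unfolding coset_edges_def by blast
  have "- b + a = - (- a + b)" by (simp add: minus_add)
  from this *(7) have "- b + a \<in> uminus ` T" by (rule image_eqI)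
  with * show ?r by (auto simp: doubleton_eq_iff)
next
  assume ?r
  then obtain a b where *: "A \<in> coset_vertices H" "B \<in> coset_vertices H" "A \<noteq> B"
    "a \<in> A" "b \<in> B" "- a + b \<in> T \<union> uminus ` T" by blast
  show ?l
  proof (cases "- a + b \<in> T")
    case True
    with * show ?thesis unfolding coset_edges_def by blast
  next
    case False
    with * obtain t where "- a + b = - t" "t \<in> T" by blast
    then have "- b + a \<in> T" by (metis minus_add minus_minus)
    with * have "{B, A} \<in> coset_edges H T" unfolding coset_edges_def by blast
    then show ?thesis by (simp add: insert_commute)
  qed
qed

lemma coset_edge_translate:
  assumes "{A, B} \<in> coset_edges H T"
  shows "{translate g A, translate g B} \<in> coset_edges H T"
proof -
  from assms obtain a b where *: "A \<in> coset_vertices H" "B \<in> coset_vertices H" "A \<noteq> B"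
    "a \<in> A" "b \<in> B" "- a + b \<in> T \<union> uminus ` T" unfolding coset_edge_iff by blast
  have "translate g A \<in> coset_vertices H" "translate g B \<in> coset_vertices H"
    using *(1,2) unfolding coset_vertices_def by (auto simp: translate_translate)
  moreover have "translate g A \<noteq> translate g B"
    using *(3) by (metis translate_translate translate_0 add.left_inverse)
  moreover have "g + a \<in> translate g A" "g + b \<in> translate g B"
    using *(4,5) by (simp_all add: mem_translate)
  moreover have "- (g + a) + (g + b) = - a + b"
    by (simp add: minus_add add.assoc del: add_uminus_conv_diff)
  ultimately show ?thesis unfolding coset_edge_iff using *(6) by metis
qed

lemma graph_action_translate: "graph_action translate (coset_vertices H) (coset_edges H T)"
  unfolding graph_action_def group_action_on_def
proof (intro conjI allI ballI)
  show "translate g A \<in> coset_vertices H" if "A \<in> coset_vertices H" for g A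
    using that unfolding coset_vertices_def by (auto simp: translate_translate)
  show "{translate g A, translate g B} \<in> coset_edges H T \<longleftrightarrow> {A, B} \<in> coset_edges H T" for g A B
    using coset_edge_translate[of A B H T g]
      coset_edge_translate[of "translate g A" "translate g B" H T "- g"]
    by (auto simp: translate_translate translate_0)
qed (simp_all add: translate_0 translate_translate)

lemma vertex_transitive_translate: "vertex_transitive translate (coset_vertices H)"
  unfolding vertex_transitive_def
proof (intro ballI)
  fix A B assume "A \<in> coset_vertices H" "B \<in> coset_vertices H"
  then obtain g h where "A = translate g H" "B = translate h H"
    unfolding coset_vertices_def by blast
  then have "translate (h + - g) A = B" by (simp add: translate_translate add.assoc)
  then show "\<exists>k. translate k A = B" ..
qed

text \<open>
  Stabilizers are conjugates of \<open>H\<close>; this yields both their openness and their coarse boundedness.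
\<close>

lemma stabilizer_translate:
  assumes H: "add_subgroup H"
  shows "stabilizer translate (translate g H) = {k. - g + k + g \<in> H}"
proof -
  have "translate a H = H \<longleftrightarrow> a \<in> H" for a
  proof
    assume "translate a H = H"
    moreover have "a \<in> translate a H" using H by (simp add: mem_translate add_subgroup_def)
    ultimately show "a \<in> H" by simp
  next
    assume a: "a \<in> H"
    have "- a + b \<in> H \<longleftrightarrow> b \<in> H" for b
    proof
      assume "- a + b \<in> H"
      then have "a + (- a + b) \<in> H" using H a unfolding add_subgroup_def by blast
      then show "b \<in> H" by simp
    next
      assume "b \<in> H"
      then show "- a + b \<in> H" using H a unfolding add_subgroup_def by blast
    qed
    then show "translate a H = H" by (intro set_eqI) (simp only: mem_translate)
  qed
  \<comment> \<open>conjugation by \<open>g\<close> reduces to the coset \<open>H\<close> itself\<close>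
  moreover have "translate k (translate g H) = translate g H \<longleftrightarrow>
      translate (- g + k + g) H = H" for k
    by (metis translate_translate translate_0 add.left_inverse add.right_inverse)
  ultimately show ?thesis unfolding stabilizer_def by blast
qed

lemma continuous_graph_action_translate:
  fixes H :: "'g::topological_group_add set"
  assumes H: "add_subgroup H" "open H"
  shows "continuous_graph_action translate (coset_vertices H) (coset_edges H T)"
  unfolding continuous_graph_action_iff_open_stabilizers
proof (intro conjI ballI graph_action_translate)
  fix A assume "A \<in> coset_vertices H"
  then obtain g where A: "A = translate g H" unfolding coset_vertices_def by blast
  have "open ((\<lambda>k. - g + k + g) -` H)"
    by (rule open_vimage[OF H(2)]) (intro continuous_intros)
  then show "open (stabilizer translate A)"
    unfolding A stabilizer_translate[OF H(1)] vimage_def .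
qed

lemma coset_eqI:
  assumes H: "add_subgroup H" and "- g + h \<in> H"
  shows "translate g H = translate h H"
proof -
  have "h + - g \<in> stabilizer translate (translate g H)"
    using assms by (simp add: stabilizer_translate add.assoc del: add_uminus_conv_diff)
  then show ?thesis by (simp add: stabilizer_def translate_translate add.assoc)
qed

text \<open>
  Reading a word letter by letter moves along the graph; letters that do not change the coset, in
  particular those from \<open>H\<close>, are skipped.
\<close>

lemma walk_of_word:
  assumes H: "add_subgroup H" and w: "set w \<subseteq> (T \<union> H) \<union> uminus ` (T \<union> H)"
  shows "\<exists>p. walk (coset_vertices H) (coset_edges H T) p (translate g H)
                 (translate (g + sum_list w) H) \<and> length p \<le> Suc (length w)"
  using w
proof (induction w arbitrary: g)
  case Nil
  show ?case
    by (rule exI[of _ "[translate g H]"]) (auto simp: walk_def coset_vertices_def)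
next
  case (Cons a w)
  let ?A = "translate g H" and ?B = "translate (g + a) H"
  obtain p where "walk (coset_vertices H) (coset_edges H T) p ?B
      (translate (g + a + sum_list w) H)" and len: "length p \<le> Suc (length w)"
    using Cons.IH[of "g + a"] Cons.prems by auto
  then have p: "walk (coset_vertices H) (coset_edges H T) p ?B
      (translate (g + sum_list (a # w)) H)" by (simp add: add.assoc)
  show ?case
  proof (cases "?A = ?B")
    case True
    with p len show ?thesis by (intro exI[of _ p]) auto
  next
    case False
    have "a \<notin> H" "- a \<notin> H"
      using False coset_eqI[OF H, of g "g + a"] H unfolding add_subgroup_def
      by (auto simp: add.assoc[symmetric])
    then have "a \<in> T \<union> uminus ` T" using Cons.prems by force
    then have "- g + (g + a) \<in> T \<union> uminus ` T" by simp
    moreover have "g \<in> ?A" "g + a \<in> ?B"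
      using H by (simp_all add: mem_translate add_subgroup_def)
    moreover have "?A \<in> coset_vertices H" "?B \<in> coset_vertices H"
      unfolding coset_vertices_def by blast+
    ultimately have "{?A, ?B} \<in> coset_edges H T"
      unfolding coset_edge_iff using False by blast
    with p len show ?thesis
      by (intro exI[of _ "?A # p"]) (auto simp: walk_def successively_Cons coset_vertices_def)
  qed
qed

text \<open>
  An edge joins some representatives of two cosets by an element of \<open>T\<close>, up to sign. Between
  consecutive edges a letter from \<open>H\<close> changes the representative, which doubles the length.
\<close>

lemma word_of_walk:
  assumes H: "add_subgroup H"
    and p: "walk (coset_vertices H) (coset_edges H T) p A B" and ab: "a \<in> A" "b \<in> B"
  shows "- a + b \<in> word_ball (T \<union> H) (2 * length p)"
  using p ab
proof (induction p arbitrary: A a)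
  case Nil
  then show ?case by (simp add: walk_def)
next
  case (Cons A' p)
  have coset: "- a + a' \<in> word_ball (T \<union> H) 1"
    if A: "A \<in> coset_vertices H" and a': "a' \<in> A" for a'
  proof (rule letter_in_word_ball)
    obtain g where g: "A = translate g H" using A unfolding coset_vertices_def by blast
    have "- (- g + a) + (- g + a') \<in> H"
      using H Cons.prems(2) a' unfolding g mem_translate add_subgroup_def by blast
    then show "- a + a' \<in> T \<union> H"
      by (simp add: minus_add add.assoc del: add_uminus_conv_diff)
  qed
  have A: "A' = A" "A \<in> coset_vertices H" using Cons.prems(1) by (auto simp: walk_def)
  show ?case
  proof (cases p)
    case Nil
    then have "B = A" using Cons.prems(1) A by (simp add: walk_def)
    then have "- a + b \<in> word_ball (T \<union> H) 1" using coset[OF A(2), of b] Cons.prems(3) by simp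
    then show ?thesis by (rule word_ball_mono[rotated]) simp
  next
    case (Cons B' q)
    have B': "walk (coset_vertices H) (coset_edges H T) p B' B" "{A, B'} \<in> coset_edges H T"
      using Cons.prems(1) A Cons by (auto simp: walk_def)
    then obtain a' b' where ab: "a' \<in> A" "b' \<in> B'" "- a' + b' \<in> T \<union> uminus ` T"
      unfolding coset_edge_iff by blast
    have "- a' + b' \<in> word_ball (T \<union> H) 1"
      using ab(3) letter_in_word_ball[of _ "T \<union> H"]
      by (elim UnE imageE) (auto intro!: word_ball_uminus)
    then have "(- a + a') + ((- a' + b') + (- b' + b)) \<in>
        word_ball (T \<union> H) (1 + (1 + 2 * length p))"
      using coset[OF A(2) ab(1)] Cons.IH[OF B'(1) ab(2) Cons.prems(3)]
      by (intro word_ball_add)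
    then show ?thesis by (simp add: add.assoc)
  qed
qed

lemma graph_dist_le:
  assumes "walk V E p u w" "length p \<le> Suc n"
  shows "graph_dist V E u w \<le> real n"
proof -
  have "length p = Suc (length p - 1)" using assms(1) by (cases p) (auto simp: walk_def)
  then have "(LEAST n. \<exists>p. walk V E p u w \<and> length p = Suc n) \<le> length p - 1"
    by (intro Least_le) (use assms(1) in blast)
  with assms(2) show ?thesis unfolding graph_dist_def by linarith
qed

lemma graph_dist_attained:
  assumes "connected_graph V E" "u \<in> V" "w \<in> V"
  obtains p where "walk V E p u w" "real (length p) = graph_dist V E u w + 1"
proof -
  let ?P = "\<lambda>n. \<exists>p. walk V E p u w \<and> length p = Suc n"
  from assms obtain p where p: "walk V E p u w" unfolding connected_graph_def by blast
  then have "length p = Suc (length p - 1)" by (cases p) (auto simp: walk_def)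
  with p have "?P (length p - 1)" by blast
  then have "?P (LEAST n. ?P n)" by (rule LeastI)
  then show thesis using that unfolding graph_dist_def by fastforce
qed

lemma connected_coset_graph:
  assumes H: "add_subgroup H" and gen: "generating_set (T \<union> H)"
  shows "connected_graph (coset_vertices H) (coset_edges H T)"
  unfolding connected_graph_def
proof (intro conjI ballI)
  show "simple_graph (coset_vertices H) (coset_edges H T)"
    unfolding simple_graph_def coset_edges_def by blast
  show "coset_vertices H \<noteq> {}" unfolding coset_vertices_def by blast
  fix A B assume "A \<in> coset_vertices H" "B \<in> coset_vertices H"
  then obtain g h where AB: "A = translate g H" "B = translate h H"
    unfolding coset_vertices_def by blast
  obtain w where "set w \<subseteq> (T \<union> H) \<union> uminus ` (T \<union> H)" "- g + h = sum_list w"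
    using gen unfolding generating_set_iff_word_balls word_ball_def by blast
  with walk_of_word[OF H, of w T g] AB
  show "\<exists>p. walk (coset_vertices H) (coset_edges H T) p A B"
    by (metis add_minus_cancel)
qed

lemma word_metric_equivalent_coset_graph:
  assumes H: "add_subgroup H" and gen: "generating_set (T \<union> H)"
  shows "word_metric (T \<union> H) \<asymp>
    orbit_pseudometric translate (graph_dist (coset_vertices H) (coset_edges H T)) H"
    (is "_ \<asymp> orbit_pseudometric translate ?d H")
  unfolding equivalent_def
proof
  have "?d (translate g H) (translate h H) \<le> 1 * word_metric (T \<union> H) g h + 0" for g h
  proof -
    obtain n where n: "word_metric (T \<union> H) g h = real n" "- g + h \<in> word_ball (T \<union> H) n"
      using gen by (rule word_metric_attained)
    then obtain w where w: "set w \<subseteq> (T \<union> H) \<union> uminus ` (T \<union> H)" "length w \<le> n"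
      "- g + h = sum_list w"
      unfolding word_ball_def by blast
    have "g + sum_list w = h" unfolding w(3)[symmetric] by simp
    with walk_of_word[OF H w(1), of g] obtain p where
      "walk (coset_vertices H) (coset_edges H T) p (translate g H) (translate h H)"
      "length p \<le> Suc (length w)" by auto
    with w(2) n(1) show ?thesis
      using graph_dist_le[of "coset_vertices H" "coset_edges H T" p] by fastforce
  qed
  then show "word_metric (T \<union> H) \<succeq> orbit_pseudometric translate ?d H"
    unfolding dominates_def orbit_pseudometric_def
    by (intro exI[of _ 1] conjI exI[of _ 0]) auto
  have "word_metric (T \<union> H) g h \<le> 2 * ?d (translate g H) (translate h H) + 2" for g h
  proof -
    obtain p where p: "walk (coset_vertices H) (coset_edges H T) p (translate g H) (translate h H)"
      "real (length p) = ?d (translate g H) (translate h H) + 1"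
      by (rule graph_dist_attained[OF connected_coset_graph[OF H gen],
            of "translate g H" "translate h H"])
        (auto simp: coset_vertices_def)
    have "- g + h \<in> word_ball (T \<union> H) (2 * length p)"
      by (rule word_of_walk[OF H p(1)]) (use H in \<open>auto simp: mem_translate add_subgroup_def\<close>)
    from word_metric_le[OF this] p(2) show ?thesis by simp
  qed
  then show "orbit_pseudometric translate ?d H \<succeq> word_metric (T \<union> H)"
    unfolding dominates_def orbit_pseudometric_def
    by (intro exI[of _ 2] conjI) auto
qed

text \<open>
  An edge with representatives \<open>a\<close> and \<open>a + t\<close> is the translate by \<open>a\<close> of the edge from \<open>H\<close> to \<open>t + H\<close>.
\<close>

lemma finite_edge_orbits_coset_graph:
  assumes H: "add_subgroup H" and T: "finite T"
  shows "finite (edge_orbits translate (coset_edges H T))"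
proof (rule finite_subset)
  let ?O = "\<lambda>t. range (\<lambda>g. translate g ` {H, translate t H})"
  show "finite (?O ` T)" using T by simp
  show "edge_orbits translate (coset_edges H T) \<subseteq> ?O ` T"
  proof
    fix X assume "X \<in> edge_orbits translate (coset_edges H T)"
    then obtain A B a b where AB: "A \<in> coset_vertices H" "B \<in> coset_vertices H"
      "a \<in> A" "b \<in> B" "- a + b \<in> T" and X: "X = range (\<lambda>g. translate g ` {A, B})"
      unfolding edge_orbits_def coset_edges_def by blast
    have rep: "C = translate c H" if C: "C \<in> coset_vertices H" "c \<in> C" for C c
    proof -
      obtain g where g: "C = translate g H" using C(1) unfolding coset_vertices_def by blast
      with C(2) show ?thesis using coset_eqI[OF H] by (simp add: mem_translate)
    qed
    define t where "t = - a + b"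
    have "A = translate a H" "B = translate a (translate t H)"
      using rep AB by (auto simp: t_def translate_translate)
    then have eq: "translate g ` {A, B} = translate (g + a) ` {H, translate t H}" for g
      by (simp add: translate_translate add.assoc)
    then have "X = (\<lambda>g. translate g ` {H, translate t H}) ` range (\<lambda>g. g + a)"
      by (simp only: X image_image eq)
    also have "range (\<lambda>g. g + a) = UNIV"
      by (rule surjI[of _ "\<lambda>g. g - a"]) simp
    finally show "X \<in> ?O ` T" using AB(5) t_def by blast
  qed
qed

section \<open>Coarsely bounded sets\<close>

lemma coarsely_bounded_subset: "coarsely_bounded B \<Longrightarrow> A \<subseteq> B \<Longrightarrow> coarsely_bounded A"
  unfolding coarsely_bounded_def by blast

lemma coarsely_bounded_conjugate:
  assumes "coarsely_bounded H"
  shows "coarsely_bounded {k. - g + k + g \<in> H}"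
  unfolding coarsely_bounded_def
proof
  fix d :: "'a \<Rightarrow> 'a \<Rightarrow> real" assume d: "d \<in> PMet"
  with assms obtain C where C: "\<And>h h'. h \<in> H \<Longrightarrow> h' \<in> H \<Longrightarrow> d h h' \<le> C"
    unfolding coarsely_bounded_def by blast
  have sym: "d a b = d b a" and tri: "d a c \<le> d a b + d b c"
    and inv: "d (k + a) (k + b) = d a b" for k a b c
    using d unfolding PMet_def pseudometric_def left_invariant_def by auto
  have "d k k' \<le> C + 2 * d 0 g" if "- g + k + g \<in> H" "- g + k' + g \<in> H" for k k'
  proof -
    have "d k k' \<le> d k (k + g) + (d (k + g) (k' + g) + d (k' + g) k')"
      using tri[of k k' "k + g"] tri[of "k + g" k' "k' + g"] by linarith
    moreover have "d (k + g) (k' + g) \<le> C"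
      using C[OF that] inv[of "- g" "k + g" "k' + g"] by (simp add: add.assoc)
    moreover have "d k (k + g) = d 0 g" "d (k' + g) k' = d 0 g"
      using inv[of k 0 g] inv[of k' g 0] sym[of g 0] by auto
    ultimately show ?thesis by linarith
  qed
  then show "\<exists>C. \<forall>a\<in>{k. - g + k + g \<in> H}. \<forall>b\<in>{k. - g + k + g \<in> H}. d a b \<le> C" by blast
qed

text \<open>
  Coarse boundedness is tested on one pseudometric: elements of \<open>H\<close> are free, which makes it continuous
  because \<open>H\<close> is open, and the coset representative number \<open>i\<close> costs \<open>i + 1\<close>. A word of cost below \<open>M\<close>
  only involves the first \<open>M\<close> representatives, at most \<open>M\<close> times, and neighbouring letters
  from \<open>H\<close> can be merged.
\<close>

lemma coarsely_bounded_word_ball: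
  fixes S :: "'g::topological_group_add set"
  assumes H: "add_subgroup H" "open H" and count: "countable (coset_vertices H)"
    and S: "coarsely_bounded S" "0 \<in> S"
  obtains F n where "finite F" "S \<subseteq> word_ball (F \<union> H) n"
proof -
  have "coset_vertices H \<noteq> {}" unfolding coset_vertices_def by blast
  with count have "coset_vertices H = range (from_nat_into (coset_vertices H))"
    by (simp add: range_from_nat_into)
  moreover have "\<forall>i. \<exists>f. from_nat_into (coset_vertices H) i = translate f H"
    using from_nat_into[OF \<open>coset_vertices H \<noteq> {}\<close>] unfolding coset_vertices_def by blast
  then obtain f where f: "\<And>i. from_nat_into (coset_vertices H) i = translate (f i) H" by metis
  ultimately have cosets: "coset_vertices H = range (\<lambda>i. translate (f i) H)" by simp
  define Q where "Q = H \<times> {0::real} \<union> {(a, real (Suc i)) |a i. a \<in> {f i, - f i}}"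
  interpret weighted_letters Q
  proof
    show "0 \<le> c" if "(a, c) \<in> Q" for a c using that by (auto simp: Q_def)
    show "(- a, c) \<in> Q" if "(a, c) \<in> Q" for a c
      using that H(1) unfolding Q_def add_subgroup_def by auto
    show "\<exists>w. set w \<subseteq> Q \<and> sum_list (map fst w) = g" for g
    proof -
      have "g \<in> translate g H" using H(1) by (simp add: mem_translate add_subgroup_def)
      moreover have "translate g H \<in> range (\<lambda>i. translate (f i) H)"
        unfolding cosets[symmetric] coset_vertices_def by blast
      then obtain i where "translate g H = translate (f i) H" by (rule imageE)
      ultimately have "g \<in> translate (f i) H" by simp
      then have "- f i + g \<in> H" by (simp add: mem_translate)
      then show ?thesis
        by (intro exI[of _ "[(f i, real (Suc i)), (- f i + g, 0)]"]) (auto simp: Q_def)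
    qed
  qed
  let ?d = "weighted_pseudometric Q"
  have "?d \<in> PMet"
  proof (rule PMet_I[OF pseudometric_weighted left_invariant_weighted])
    fix e :: real assume "0 < e"
    have "?d 0 g \<le> e" if "g \<in> H" for g
      using weighted_pseudometric_letter[of g 0] that \<open>0 < e\<close> unfolding Q_def by force
    moreover have "identity_neighborhood H"
      using H by (simp add: identity_neighborhood_def interior_open add_subgroup_def)
    ultimately show "\<exists>U. identity_neighborhood U \<and> (\<forall>g\<in>U. ?d 0 g \<le> e)" by blast
  qed
  with S obtain C where C: "\<And>s. s \<in> S \<Longrightarrow> ?d 0 s \<le> C"
    unfolding coarsely_bounded_def by blast
  obtain M :: nat where M: "C < real M" using reals_Archimedean2 by blast
  define F where "F = f ` {..<M}"
  \<comment> \<open>the initial element \<open>h\<close> collects a run of free letters, which must not count towards the length\<close>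
  have word: "\<exists>h\<in>H. \<exists>n. real n \<le> 2 * sum_list (map snd w) \<and>
      - h + sum_list (map fst w) \<in> word_ball (F \<union> H) n"
    if "set w \<subseteq> Q" "sum_list (map snd w) < real M" for w
    using that
  proof (induction w)
    case Nil
    then show ?case
      using H(1) zero_in_word_ball[of "F \<union> H" 0]
      by (intro bexI[of _ 0] exI[of _ 0]) (auto simp: add_subgroup_def)
  next
    case (Cons p w)
    have w: "0 \<le> sum_list (map snd w)" using Cons.prems by (intro weight_nonneg) auto
    moreover have p: "p \<in> Q" "0 \<le> snd p" using Cons.prems nonneg[of "fst p" "snd p"] by auto
    ultimately obtain h n where h: "h \<in> H" and n: "real n \<le> 2 * sum_list (map snd w)"
      and u: "- h + sum_list (map fst w) \<in> word_ball (F \<union> H) n"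
      using Cons by force
    show ?case
    proof (cases "p \<in> H \<times> {0}")
      case True
      have "- (fst p + h) + sum_list (map fst (p # w)) = - h + sum_list (map fst w)"
        by (simp add: minus_add add.assoc del: add_uminus_conv_diff)
      moreover have "fst p + h \<in> H" using True h H(1) unfolding add_subgroup_def by auto
      ultimately show ?thesis
        using n u True by (intro bexI[of _ "fst p + h"] exI[of _ n]) auto
    next
      case False
      with p obtain a i where a: "p = (a, real (Suc i))" "a \<in> {f i, - f i}"
        unfolding Q_def by blast
      have "i < M" using Cons.prems(2) w a(1) by simp
      then have "f i \<in> word_ball (F \<union> H) 1" unfolding F_def by (intro letter_in_word_ball) blast
      then have "a \<in> word_ball (F \<union> H) 1" using a(2) word_ball_uminus by blast
      moreover have "h \<in> word_ball (F \<union> H) 1" using h by (intro letter_in_word_ball) blast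
      ultimately have "a + (h + (- h + sum_list (map fst w))) \<in> word_ball (F \<union> H) (1 + (1 + n))"
        using u by (intro word_ball_add)
      moreover have "real (1 + (1 + n)) \<le> 2 * sum_list (map snd (p # w))"
        using n a(1) by simp
      moreover have "0 \<in> H" using H(1) by (simp add: add_subgroup_def)
      ultimately show ?thesis
        by (intro bexI[of _ 0] exI[of _ "1 + (1 + n)"]) (auto simp: a(1))
    qed
  qed
  have "S \<subseteq> word_ball (F \<union> H) (1 + 2 * M)"
  proof
    fix s assume "s \<in> S"
    with C M have "?d 0 s < real M" by force
    then obtain w where w: "set w \<subseteq> Q" "sum_list (map fst w) = - 0 + s"
      "sum_list (map snd w) < real M" by (rule weighted_pseudometric_less)
    from word[OF w(1,3)] w(2) obtain h n where h: "h \<in> H" "- h + s \<in> word_ball (F \<union> H) n"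
      and n: "real n \<le> 2 * sum_list (map snd w)" by auto
    have "h \<in> word_ball (F \<union> H) 1" using h by (intro letter_in_word_ball) blast
    from word_ball_add[OF this h(2)] have "s \<in> word_ball (F \<union> H) (1 + n)" by simp
    moreover have "real n < 2 * real M" using n w(3) by linarith
    then have "1 + n \<le> 1 + 2 * M" by linarith
    ultimately show "s \<in> word_ball (F \<union> H) (1 + 2 * M)" using word_ball_mono by blast
  qed
  then show thesis using that[of F] unfolding F_def by blast
qed

lemma finite_subset_word_ball:
  assumes "generating_set S" "finite F"
  shows "\<exists>n. F \<subseteq> word_ball S n"
  using assms(2)
proof (induction F rule: finite_induct)
  case (insert a F)
  obtain n where n: "F \<subseteq> word_ball S n" using insert by blast
  obtain m where m: "a \<in> word_ball S m"
    using assms(1) unfolding generating_set_iff_word_balls by blast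
  have "insert a F \<subseteq> word_ball S (max m n)"
    using m n by (auto intro: word_ball_mono[OF max.cobounded1] word_ball_mono[OF max.cobounded2])
  then show ?case ..
qed simp

text \<open>
  The edges come from a finite set if \<open>S\<close> is coarsely bounded and there are countably many cosets, and
  from \<open>S\<close> otherwise. The vertex set is the same in both cases, so the case distinction can be made
  before the graph is built.
\<close>

theorem non_archimedean_coset_graph:
  fixes S :: "'g::topological_group_add set"
  assumes S: "generating_set S" "identity_neighborhood S" and na: "non_archimedean TYPE('g)"
  obtains V E v where "connected_graph V E" "continuous_graph_action translate V E"
    "vertex_transitive translate V" "v \<in> V"
    "word_metric S \<asymp> orbit_pseudometric translate (graph_dist V E) v"
    "coarsely_bounded S \<Longrightarrow> countable V \<Longrightarrow> Cayley_Abels_Rosendal_graph translate V E"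
proof -
  obtain H where H: "add_subgroup H" "open H" "H \<subseteq> S"
    using na S(2) unfolding non_archimedean_def by blast
  have "0 \<in> S" using H by (auto simp: add_subgroup_def)
  have "\<exists>T. generating_set (T \<union> H) \<and> word_metric S \<asymp> word_metric (T \<union> H) \<and>
      (coarsely_bounded S \<and> countable (coset_vertices H) \<longrightarrow> finite T)"
  proof (cases "coarsely_bounded S \<and> countable (coset_vertices H)")
    case True
    then obtain F n where F: "finite F" "S \<subseteq> word_ball (F \<union> H) n"
      using coarsely_bounded_word_ball[OF H(1,2)] \<open>0 \<in> S\<close> by blast
    obtain m where m: "F \<subseteq> word_ball S m" using finite_subset_word_ball[OF S(1) F(1)] ..
    have "F \<union> H \<subseteq> word_ball S (m + 1)"
      using m H(3) letter_in_word_ball[of _ S] word_ball_mono[of m "m + 1" _ S]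
        word_ball_mono[of 1 "m + 1" _ S] by auto
    moreover have "generating_set (F \<union> H)" using S(1) F(2) by (rule generating_set_by_word_ball)
    ultimately show ?thesis
      using F S(1) word_metric_dominates_word_metric unfolding equivalent_def by blast
  next
    case False
    have "S \<union> H = S" using H(3) by blast
    moreover have "word_metric S \<succeq> word_metric S"
      using word_metric_dominates_word_metric[OF S(1) S(1)] letter_in_word_ball by blast
    ultimately show ?thesis using False S(1)
      by (intro exI[of _ S]) (auto simp: equivalent_def)
  qed
  then obtain T where T: "generating_set (T \<union> H)" "word_metric S \<asymp> word_metric (T \<union> H)"
    "coarsely_bounded S \<Longrightarrow> countable (coset_vertices H) \<Longrightarrow> finite T" by blast
  let ?V = "coset_vertices H" and ?E = "coset_edges H T"
  show thesis
  proof (rule that[of ?V ?E H])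
    show conn: "connected_graph ?V ?E" by (rule connected_coset_graph[OF H(1) T(1)])
    show cont: "continuous_graph_action translate ?V ?E"
      by (rule continuous_graph_action_translate[OF H(1,2)])
    show trans: "vertex_transitive translate ?V" by (rule vertex_transitive_translate)
    have "translate 0 H \<in> ?V" unfolding coset_vertices_def by blast
    then show "H \<in> ?V" by (simp add: translate_0)
    show "word_metric S \<asymp> orbit_pseudometric translate (graph_dist ?V ?E) H"
      using T(2) word_metric_equivalent_coset_graph[OF H(1) T(1)] by (rule equivalent_trans)
    show "Cayley_Abels_Rosendal_graph translate ?V ?E"
      if "coarsely_bounded S" "countable ?V"
    proof -
      have "coarsely_bounded (stabilizer translate A)" if V: "A \<in> ?V" for A
      proof -
        obtain g where A: "A = translate g H" using V unfolding coset_vertices_def by blast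
        have "coarsely_bounded H" using \<open>coarsely_bounded S\<close> H(3) by (rule coarsely_bounded_subset)
        then show ?thesis
          unfolding A stabilizer_translate[OF H(1)] by (rule coarsely_bounded_conjugate)
      qed
      then show ?thesis
        unfolding Cayley_Abels_Rosendal_graph_def
        using conn cont trans that finite_edge_orbits_coset_graph[OF H(1) T(3)[OF that]] by blast
    qed
  qed
qed

section \<open>Geodesic spaces\<close>

lemma geodesic_space_connected:
  assumes "geodesic_space TYPE('x::metric_space)"
  shows "connected (UNIV :: 'x set)"
proof (rule path_connected_imp_connected)
  show "path_connected (UNIV :: 'x set)"
    using assms unfolding path_connected_def geodesic_space_def by blast
qed

lemma geodesic_space_between:
  fixes p q :: "'x::metric_space"
  assumes geo: "geodesic_space TYPE('x)" and a: "0 \<le> a" "a \<le> dist p q"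
  obtains z where "dist p z = a" "dist z q \<le> dist p q - a"
proof -
  obtain \<gamma> where \<gamma>: "path \<gamma>" "\<gamma> 0 = p" "\<gamma> 1 = q" "curve_length \<gamma> = ereal (dist p q)"
    using geo unfolding geodesic_space_def pathstart_def pathfinish_def by blast
  have "\<exists>s. 0 \<le> s \<and> s \<le> 1 \<and> dist p (\<gamma> s) = a"
    by (rule IVT') (use \<gamma> a in \<open>auto simp: path_def intro!: continuous_intros\<close>)
  then obtain s where s: "0 \<le> s" "s \<le> 1" "dist p (\<gamma> s) = a" by blast
  \<comment> \<open>subdividing at \<open>s\<close> shows that \<open>\<gamma> s\<close> lies metrically between \<open>p\<close> and \<open>q\<close>\<close>
  define t where "t i = (if i = 0 then 0 else if i = 1 then s else 1)" for i :: nat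
  have "mono_on {..2} t" "t ` {..2} \<subseteq> {0..1}"
    using s by (auto simp: mono_on_def t_def)
  then have "ereal (\<Sum>i<2. dist (\<gamma> (t i)) (\<gamma> (t (Suc i)))) \<le> curve_length \<gamma>"
    unfolding curve_length_def by (intro SUP_upper2[of "(2, t)"]) auto
  also have "(\<Sum>i<2. dist (\<gamma> (t i)) (\<gamma> (t (Suc i)))) = dist p (\<gamma> s) + dist (\<gamma> s) q"
    using \<gamma> by (simp add: numeral_2_eq_2 t_def)
  finally have "dist p (\<gamma> s) + dist (\<gamma> s) q \<le> dist p q" using \<gamma>(4) by simp
  with s(3) show thesis by (intro that[of "\<gamma> s"]) auto
qed

section \<open>Generating sets from cobounded actions\<close>

locale isometric_group_action =
  fixes act :: "'g::group_add \<Rightarrow> 'x::metric_space \<Rightarrow> 'x"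
  assumes isometric_action: "isometric_action act"
begin

lemma act_0: "act 0 y = y" and act_add: "act (g + h) y = act g (act h y)"
  and dist_act: "dist (act g y) (act g z) = dist y z"
  using isometric_action unfolding isometric_action_def group_action_on_def by auto

definition displacement_le :: "'x \<Rightarrow> real \<Rightarrow> 'g set" where
  "displacement_le x r = {g. dist x (act g x) \<le> r}"

lemma dist_orbit: "dist x (act (- g + h) x) = dist (act g x) (act h x)"
  using dist_act[of g x "act (- g + h) x"] by (simp add: act_add[symmetric])

lemma uminus_displacement_le: "uminus ` displacement_le x r \<subseteq> displacement_le x r"
  using dist_orbit[of x _ 0] by (auto simp: displacement_le_def act_0 dist_commute)

lemma pseudometric_orbit: "pseudometric (orbit_pseudometric act dist x)"
  unfolding pseudometric_def orbit_pseudometric_def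
  by (auto simp: dist_commute dist_triangle)

lemma left_invariant_orbit: "left_invariant (orbit_pseudometric act dist x)"
  unfolding left_invariant_def orbit_pseudometric_def by (simp add: act_add dist_act)

lemma cobounded_orbit_dense:
  assumes "cobounded act"
  obtains R where "R > 0" "\<And>z. \<exists>g. dist z (act g x) < R"
proof -
  obtain y R where R: "R > 0" "(\<Union>g. act g ` ball y R) = UNIV"
    using assms unfolding cobounded_def by blast
  have "\<exists>g. dist z (act g x) < R + dist y x" for z
  proof -
    have "z \<in> (\<Union>g. act g ` ball y R)" by (simp add: R(2))
    then obtain g u where z: "z = act g u" and u: "dist y u < R" by auto
    have "dist z (act g x) = dist u x" unfolding z by (rule dist_act)
    also have "\<dots> \<le> dist y u + dist y x" using dist_triangle[of u x y] by (simp add: dist_commute)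
    finally show ?thesis using u by (intro exI[of _ g]) linarith
  qed
  moreover have "R + dist y x > 0" using R(1) by (simp add: add_pos_nonneg)
  ultimately show thesis using that by blast
qed

text \<open>
  Balls of radius \<open>R\<close> about orbit points of elements of different cosets of the generated subgroup
  are disjoint, so more than one coset would disconnect the space.
\<close>

lemma generating_set_displacement_le:
  assumes conn: "connected (UNIV :: 'x set)"
    and R: "\<And>z. \<exists>g. dist z (act g x) < R" and r: "2 * R \<le> r"
  shows "generating_set (displacement_le x r)"
proof -
  let ?S = "displacement_le x r"
  define H where "H = {g. \<exists>n. g \<in> word_ball ?S n}"
  have H: "add_subgroup H" unfolding H_def by (rule add_subgroup_word_balls)
  have S: "?S \<subseteq> H" unfolding H_def using letter_in_word_ball by blast
  define U where "U = (\<Union>g\<in>H. ball (act g x) R)"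
  define V where "V = (\<Union>g\<in>-H. ball (act g x) R)"
  have "U \<inter> V = {}"
  proof (rule ccontr)
    assume "U \<inter> V \<noteq> {}"
    then obtain z g h where gh: "g \<in> H" "h \<notin> H" "dist (act g x) z < R" "dist (act h x) z < R"
      unfolding U_def V_def by auto
    have "dist (act g x) (act h x) \<le> r"
      using dist_triangle2[of "act g x" "act h x" z] gh r by linarith
    then have "- g + h \<in> H" using S by (auto simp: displacement_le_def dist_orbit)
    then have "g + (- g + h) \<in> H" using H gh(1) unfolding add_subgroup_def by blast
    with gh(2) show False by simp
  qed
  moreover have "UNIV \<subseteq> U \<union> V"
    using R unfolding U_def V_def by (fastforce simp: dist_commute)
  moreover have "open U" "open V" unfolding U_def V_def by auto
  ultimately have "U = {} \<or> V = {}" using connectedD[OF conn, of U V] by auto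
  moreover have "R > 0" using R[of x] zero_le_dist le_less_trans by blast
  ultimately have "H = {} \<or> - H = {}" unfolding U_def V_def by auto
  moreover have "0 \<in> H" using H by (simp add: add_subgroup_def)
  ultimately have "H = UNIV" by blast
  then show ?thesis unfolding generating_set_iff_word_balls H_def by blast
qed

text \<open>
  The induction runs over points \<open>z\<close> of the space rather than over group elements: the distance of \<open>z\<close>
  from \<open>x\<close> drops by 1 in each step, and \<open>z\<close> is rounded to an orbit point only afterwards, so the
  rounding errors do not accumulate.
\<close>

lemma geodesic_word_ball:
  assumes geo: "geodesic_space TYPE('x)"
    and R: "\<And>z. \<exists>g. dist z (act g x) < R" and r: "2 * R + 1 \<le> r"
    and "dist x z \<le> real n" "dist z (act g x) < R"
  shows "g \<in> word_ball (displacement_le x r) (Suc n)"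
  using assms(4,5)
proof (induction n arbitrary: z g)
  case 0
  have "0 < R" using R[of x] zero_le_dist le_less_trans by blast
  with 0 r have "g \<in> displacement_le x r" by (simp add: displacement_le_def)
  then show ?case using letter_in_word_ball by (metis One_nat_def)
next
  case (Suc n)
  obtain y where y: "dist x y \<le> real n" "dist y z \<le> 1"
  proof (cases "dist x z \<le> real n")
    case True
    then show ?thesis using that[of z] by simp
  next
    case False
    then obtain y where "dist x y = real n" "dist y z \<le> dist x z - real n"
      using geodesic_space_between[OF geo, of "real n" x z] by auto
    with Suc.prems(1) show ?thesis using that[of y] by simp
  qed
  obtain h where h: "dist y (act h x) < R" using R by blast
  have "dist (act h x) (act g x) \<le> dist y (act h x) + dist y z + dist z (act g x)"
    using dist_triangle[of "act h x" "act g x" y] dist_triangle[of y "act g x" z]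
    by (simp add: dist_commute)
  also have "\<dots> \<le> r" using h y(2) Suc.prems(2) r by linarith
  finally have "- h + g \<in> word_ball (displacement_le x r) 1"
    by (intro letter_in_word_ball) (simp add: displacement_le_def dist_orbit)
  from word_ball_add[OF Suc.IH[OF y(1) h] this] show ?case by simp
qed

lemma orbit_dominates_word_metric:
  assumes geo: "geodesic_space TYPE('x)"
    and R: "\<And>z. \<exists>g. dist z (act g x) < R" and r: "2 * R + 1 \<le> r"
  shows "orbit_pseudometric act dist x \<succeq> word_metric (displacement_le x r)"
proof -
  have "R > 0" using R[of x] zero_le_dist le_less_trans by blast
  have "word_metric (displacement_le x r) g h \<le> 1 * orbit_pseudometric act dist x g h + 2" for g h
  proof -
    let ?D = "dist x (act (- g + h) x)"
    define n where "n = nat \<lceil>?D\<rceil>"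
    have n: "?D \<le> real n" "real n \<le> ?D + 1"
      unfolding n_def using zero_le_dist[of x "act (- g + h) x"] by linarith+
    have "- g + h \<in> word_ball (displacement_le x r) (Suc n)"
      by (rule geodesic_word_ball[OF geo R r n(1)]) (simp add: \<open>R > 0\<close>)
    then have "word_metric (displacement_le x r) g h \<le> real (Suc n)" by (rule word_metric_le)
    with n(2) show ?thesis by (simp add: orbit_pseudometric_def dist_orbit)
  qed
  then show ?thesis unfolding dominates_def
    by (intro exI[of _ 1] conjI exI[of _ 2]) auto
qed

end

text \<open>
  If \<open>g\<close> moves \<open>x\<close> by at most \<open>r\<close>, then the image of \<open>x\<close> under \<open>g\<close> lies in the ball of radius \<open>r + 1\<close>
  about \<open>x\<close> and in the translate of this ball by \<open>g\<close>.
\<close>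

lemma coarsely_bounded_displacement_le:
  fixes act :: "'g::topological_group_add \<Rightarrow> 'x::metric_space \<Rightarrow> 'x"
  assumes act: "metrically_coarsely_proper act" and r: "r \<ge> 0"
  shows "coarsely_bounded {g. dist x (act g x) \<le> r}"
proof (rule coarsely_bounded_subset)
  show "coarsely_bounded {g. act g ` ball x (r + 1) \<inter> ball x (r + 1) \<noteq> {}}"
    using act r unfolding metrically_coarsely_proper_def by force
  show "{g. dist x (act g x) \<le> r} \<subseteq> {g. act g ` ball x (r + 1) \<inter> ball x (r + 1) \<noteq> {}}"
  proof clarify
    fix g assume "dist x (act g x) \<le> r" "act g ` ball x (r + 1) \<inter> ball x (r + 1) = {}"
    moreover have "x \<in> ball x (r + 1)" using r by simp
    ultimately show False by fastforce
  qed
qed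

text \<open>
  Every continuous left-invariant pseudometric is bounded on a coarsely bounded generating set, hence
  dominated by its word metric.
\<close>

lemma geometry_of_word_metric:
  assumes "generating_set S" "coarsely_bounded S" "0 \<in> S" "d \<in> PMet" "d \<asymp> word_metric S"
  shows "geometry d"
  unfolding geometry_def
proof (intro conjI ballI assms(4))
  fix d' :: "'a \<Rightarrow> 'a \<Rightarrow> real" assume d': "d' \<in> PMet"
  then obtain C where "\<And>s. s \<in> S \<Longrightarrow> d' 0 s \<le> C"
    using assms(2,3) unfolding coarsely_bounded_def by blast
  then have "word_metric S \<succeq> d'"
    using d' by (intro word_metric_dominates[OF assms(1)]) (auto simp: PMet_def)
  with assms(5) show "d \<succeq> d'" unfolding equivalent_def using dominates_trans by blast
qed

theorem theoremA:
  fixes act :: "'g::topological_group_add \<Rightarrow> 'x::metric_space \<Rightarrow> 'x" and x :: 'x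
  assumes "isometric_action act" and "cobounded act"
    and "connected (UNIV :: 'x set) \<or> geodesic_space TYPE('x)"
  shows "\<exists>(S :: 'g set) (dhat :: 'g \<Rightarrow> 'g \<Rightarrow> real)
            (V :: 'g set set) (E :: 'g set set set) (actV :: 'g \<Rightarrow> 'g set \<Rightarrow> 'g set) (v :: 'g set).
    generating_set S \<and>
    (connected (UNIV :: 'x set) \<longrightarrow> word_metric S \<succeq> orbit_pseudometric act dist x) \<and>
    (geodesic_space TYPE('x) \<longrightarrow> word_metric S \<asymp> orbit_pseudometric act dist x) \<and>
    (quasi_continuous act \<longrightarrow>
       (\<exists>U\<subseteq>S. identity_neighborhood U) \<and> dhat \<in> PMet \<and> dhat \<asymp> word_metric S) \<and>
    (quasi_continuous act \<and> non_archimedean TYPE('g) \<longrightarrow>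
       connected_graph V E \<and> continuous_graph_action actV V E \<and> vertex_transitive actV V \<and>
       v \<in> V \<and> word_metric S \<asymp> orbit_pseudometric actV (graph_dist V E) v) \<and>
    (quasi_continuous act \<and> metrically_coarsely_proper act \<longrightarrow>
       coarsely_bounded S \<and> geometry dhat \<and>
       (non_archimedean TYPE('g) \<longrightarrow> countable V \<longrightarrow> Cayley_Abels_Rosendal_graph actV V E))"
proof -
  interpret isometric_group_action act by unfold_locales (rule assms(1))
  have conn: "connected (UNIV :: 'x set)" using assms(3) geodesic_space_connected by blast
  obtain R where R: "R > 0" "\<And>z. \<exists>g. dist z (act g x) < R"
    by (rule cobounded_orbit_dense[OF assms(2), of x]) blast
  obtain e where e: "quasi_continuous act \<Longrightarrow>
      \<exists>U. identity_neighborhood U \<and> (\<forall>g\<in>U. dist x (act g x) \<le> e)"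
    unfolding quasi_continuous_def by blast
  \<comment> \<open>the first bound serves generation and the geodesic estimate, the second makes \<open>S\<close> a neighborhood\<close>
  define r where "r = max (2 * R + 1) e"
  define S where "S = displacement_le x r"
  have r: "2 * R + 1 \<le> r" "2 * R \<le> r" "0 \<le> r" using R(1) by (auto simp: r_def)
  have gen: "generating_set S"
    unfolding S_def by (rule generating_set_displacement_le[OF conn R(2) r(2)])
  have zero: "0 \<in> S" using r(3) by (simp add: S_def displacement_le_def act_0)
  have dom: "word_metric S \<succeq> orbit_pseudometric act dist x"
    by (rule word_metric_dominates[OF gen pseudometric_orbit left_invariant_orbit, of _ r])
      (simp add: S_def displacement_le_def orbit_pseudometric_def act_0)
  have geo: "word_metric S \<asymp> orbit_pseudometric act dist x" if "geodesic_space TYPE('x)"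
    using dom orbit_dominates_word_metric[OF that R(2) r(1)] unfolding equivalent_def S_def by blast
  have nbhd: "identity_neighborhood S" if "quasi_continuous act"
  proof -
    from e[OF that] obtain U where U: "identity_neighborhood U" "\<forall>g\<in>U. dist x (act g x) \<le> e"
      by blast
    then have "U \<subseteq> S" by (force simp: S_def displacement_le_def r_def)
    with U(1) show ?thesis unfolding identity_neighborhood_def using interior_mono by blast
  qed
  have "\<exists>d. quasi_continuous act \<longrightarrow> d \<in> PMet \<and> d \<asymp> word_metric S"
    using continuous_equivalent_of_word_metric[OF gen nbhd] uminus_displacement_le
    unfolding S_def by blast
  then obtain dhat where dhat: "quasi_continuous act \<Longrightarrow> dhat \<in> PMet \<and> dhat \<asymp> word_metric S"
    by blast
  have "\<exists>V E v. quasi_continuous act \<and> non_archimedean TYPE('g) \<longrightarrow>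
      connected_graph V E \<and> continuous_graph_action translate V E \<and>
      vertex_transitive translate V \<and> v \<in> V \<and>
      word_metric S \<asymp> orbit_pseudometric translate (graph_dist V E) v \<and>
      (coarsely_bounded S \<longrightarrow> countable V \<longrightarrow> Cayley_Abels_Rosendal_graph translate V E)"
  proof (cases "quasi_continuous act \<and> non_archimedean TYPE('g)")
    case True
    show ?thesis
      by (rule non_archimedean_coset_graph[OF gen nbhd]) (use True in blast)+
  next
    case False
    show ?thesis by (intro exI impI) (rule notE[OF False])
  qed
  then obtain V E v where graph: "quasi_continuous act \<and> non_archimedean TYPE('g) \<longrightarrow>
      connected_graph V E \<and> continuous_graph_action translate V E \<and>
      vertex_transitive translate V \<and> v \<in> V \<and>
      word_metric S \<asymp> orbit_pseudometric translate (graph_dist V E) v \<and>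
      (coarsely_bounded S \<longrightarrow> countable V \<longrightarrow> Cayley_Abels_Rosendal_graph translate V E)"
    by (elim exE)
  have bounded: "coarsely_bounded S" if "metrically_coarsely_proper act"
    unfolding S_def displacement_le_def
    by (rule coarsely_bounded_displacement_le[OF that r(3)])
  have geometry: "geometry dhat" if "quasi_continuous act" "metrically_coarsely_proper act"
    using geometry_of_word_metric[OF gen bounded[OF that(2)] zero] dhat[OF that(1)] by blast
  show ?thesis
    by (rule exI[of _ S], rule exI[of _ dhat], rule exI[of _ V], rule exI[of _ E],
        rule exI[of _ translate], rule exI[of _ v], intro conjI impI)
      (simp_all add: gen dom geo nbhd dhat graph bounded geometry exI[of _ S])
qed

end
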